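(* Let $d\ge 2$ and $1\le m\le k$ be integers. For every Lyndon word $w\in W_{d,m}$, define a variable $x_w$ and assign it the weight $|w|$. Then, up to a linear change of coordinates, $f_{d,k,m}$ is defined by all monomials of weighted degree $k$ in the variables $\{x_w\mid w\in W_{d,m}\}$; that is, writing an element of $\mathrm{Lie}^m(\mathbb{R}^d)\otimes\mathbb{C}$ as $\sum_{w\in W_{d,m}}x_wP_w$, there is an invertible linear map $\lambda:(\mathbb{C}^d)^{\otimes k}\to(\mathbb{C}^d)^{\otimes k}\cong\mathbb{C}^{d^k}$ such that the coordinates of $\lambda\circ f_{d,k,m}$ are all the monomials of weighted degree $k$ in the variables $x_w$, each occurring once, with all the remaining coordinates (if any) equal to zero. More explicitly, let $J$ be the set of all unordered tuples (multisets) $(w_1,\dots,w_r)$ with $r\in\mathbb{N}$, $w_i\in W_{d,m}$ and $|w_1|+\dots+|w_r|=k$. Then $\mathcal{R}_{d,k,m}$ is isomorphic to the (Zariski closure of the) image of the map \[[x_w]_{w\in W_{d,m}}\mapsto [x_{w_1}\cdot\ldots\cdot x_{w_r}]_{(w_1,\dots,w_r)\in J}.\] In particular, $\mathcal{R}_{d,k,m}$ is a toric variety.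
   Context: Notation. $T((\mathbb{R}^d))=\prod_{k\ge 0}(\mathbb{R}^d)^{\otimes k}$ is the algebra (with tensor product) of formal power series in the non-commuting variables $\mathbf{1},\dots,\mathbf{d}$, and $p_k:T((\mathbb{R}^d))\to(\mathbb{R}^d)^{\otimes k}$ is the projection. Degree $k$ monomials are identified with words of length $k$ in the alphabet $\{\mathbf{1},\dots,\mathbf{d}\}$; $|w|$ is the length of $w$. For $T$ with zero constant term, $\exp(T)=\sum_{n\ge 0}T^{\otimes n}/n!$. $\mathrm{Lie}^m(\mathbb{R}^d)$ is the part of order at most $m$ of the free Lie algebra generated by $\mathbf{1},\dots,\mathbf{d}$ with bracket $[T,S]=TS-ST$, regarded as a linear subspace of $\bigoplus_{k\le m}(\mathbb{R}^d)^{\otimes k}\subset T((\mathbb{R}^d))$. A nonempty word $w$ is a Lyndon word if, whenever $w=pq$ with $p,q$ nonempty, $w<q$ in the lexicographic order. $W_{d,m}$ is the set of Lyndon words of length at most $m$ in the alphabet $\{\mathbf{1},\dots,\mathbf{d}\}$. For $w\in W_{d,m}$, $P_w$ is its bracketing: $P_w=w$ if $|w|=1$, and $P_w=[P_p,P_q]$ if $|w|\ge2$, where $w=pq$ with $p,q$ nonempty and $q$ lexicographically minimal. The set $\{P_w\mid w\in W_{d,m}\}$ is a basis of $\mathrm{Lie}^m(\mathbb{R}^d)$. $f_{d,k,m}:\mathrm{Lie}^m(\mathbb{R}^d)\otimes\mathbb{C}\to(\mathbb{C}^d)^{\otimes k}$ is the complexification of the polynomial map $p_k\circ\exp:\mathrm{Lie}^m(\mathbb{R}^d)\to(\mathbb{R}^d)^{\otimes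 k}$. The Rough Veronese variety $\mathcal{R}_{d,k,m}\subset\mathbb{P}^{d^k-1}_{\mathbb{C}}$ is the projectivization of the Zariski closure of the image of $f_{d,k,m}$. A (projective) variety is called toric if, up to a linear change of coordinates, it is the Zariski closure of the image of a map defined by monomials (no normality is required). *)

theory Defs
  imports
    Complex_Main
    "HOL-Library.Multiset"
    "HOL-Library.Poly_Mapping"
    "HOL-Library.List_Lexorder"
begin

section \<open>Non-commutative power series and Lie elements\<close>

text \<open>
  The letters are the natural numbers \<open>1, \<dots>, d\<close>.  A formal power series in these
  non-commuting letters is the function that maps a word to its coefficient.
\<close>

type_synonym 'a ncseries = "nat list \<Rightarrow> 'a"

definition words :: "nat \<Rightarrow> nat \<Rightarrow> nat list set" where
  "words d k = {u. set u \<subseteq> {1..d} \<and> length u = k}"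

definition word_series :: "nat list \<Rightarrow> 'a::comm_ring_1 ncseries" where
  "word_series w = (\<lambda>u. if u = w then 1 else 0)"

definition tensor_mult :: "'a::comm_ring_1 ncseries \<Rightarrow> 'a ncseries \<Rightarrow> 'a ncseries" where
  "tensor_mult S T = (\<lambda>u. \<Sum>i\<le>length u. S (take i u) * T (drop i u))"

definition lie_bracket :: "'a::comm_ring_1 ncseries \<Rightarrow> 'a ncseries \<Rightarrow> 'a ncseries" where
  "lie_bracket T S = (\<lambda>u. tensor_mult T S u - tensor_mult S T u)"

primrec tensor_power :: "'a::comm_ring_1 ncseries \<Rightarrow> nat \<Rightarrow> 'a ncseries" where
  "tensor_power T 0 = word_series []"
| "tensor_power T (Suc n) = tensor_mult T (tensor_power T n)"

text \<open>
  For \<open>T\<close> with zero constant term only the summands with \<open>n \<le> length u\<close> are nonzero.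
\<close>

definition tensor_exp :: "'a::real_normed_field ncseries \<Rightarrow> 'a ncseries" where
  "tensor_exp T = (\<lambda>u. suminf (\<lambda>n. tensor_power T n u / fact n))"

definition tensor_proj :: "nat \<Rightarrow> 'a::zero ncseries \<Rightarrow> 'a ncseries" where
  "tensor_proj k T = (\<lambda>u. if length u = k then T u else 0)"

inductive_set free_lie :: "nat \<Rightarrow> real ncseries set" for d :: nat where
  letter: "i \<in> {1..d} \<Longrightarrow> word_series [i] \<in> free_lie d"
| zero: "(\<lambda>_. 0) \<in> free_lie d"
| add: "S \<in> free_lie d \<Longrightarrow> T \<in> free_lie d \<Longrightarrow> (\<lambda>u. S u + T u) \<in> free_lie d"
| scale: "T \<in> free_lie d \<Longrightarrow> (\<lambda>u. c * T u) \<in> free_lie d"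
| bracket: "S \<in> free_lie d \<Longrightarrow> T \<in> free_lie d \<Longrightarrow> lie_bracket S T \<in> free_lie d"

definition lie_upto :: "nat \<Rightarrow> nat \<Rightarrow> real ncseries set" where
  "lie_upto d m = {T \<in> free_lie d. \<forall>u. m < length u \<longrightarrow> T u = 0}"

text \<open>The complexification of a real space \<open>V\<close> of series is \<open>V + \<i>V\<close>.\<close>

definition lie_upto_complex :: "nat \<Rightarrow> nat \<Rightarrow> complex ncseries set" where
  "lie_upto_complex d m =
     {\<lambda>u. Complex (A u) (B u) | A B. A \<in> lie_upto d m \<and> B \<in> lie_upto d m}"

section \<open>Lyndon words and their bracketings\<close>

text \<open>On words, \<open><\<close> is the lexicographic order (a proper prefix is smaller).\<close>

definition lyndon :: "nat list \<Rightarrow> bool" where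
  "lyndon w \<longleftrightarrow> w \<noteq> [] \<and> (\<forall>p q. w = p @ q \<and> p \<noteq> [] \<and> q \<noteq> [] \<longrightarrow> w < q)"

definition lyndon_words :: "nat \<Rightarrow> nat \<Rightarrow> nat list set" where
  "lyndon_words d m = {w. lyndon w \<and> set w \<subseteq> {1..d} \<and> length w \<le> m}"

definition min_suffix :: "nat list \<Rightarrow> nat list" where
  "min_suffix w = Min {q. \<exists>p. w = p @ q \<and> p \<noteq> [] \<and> q \<noteq> []}"

definition min_suffix_rest :: "nat list \<Rightarrow> nat list" where
  "min_suffix_rest w = take (length w - length (min_suffix w)) w"

lemma min_suffix:
  assumes "2 \<le> length w"
  shows "w = min_suffix_rest w @ min_suffix w"
    and "min_suffix_rest w \<noteq> []" and "min_suffix w \<noteq> []"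
proof -
  let ?Q = "{q. \<exists>p. w = p @ q \<and> p \<noteq> [] \<and> q \<noteq> []}"
  have "?Q \<subseteq> (\<lambda>i. drop i w) ` {..length w}"
  proof
    fix q assume "q \<in> ?Q"
    then obtain p where "w = p @ q" by auto
    then have "q = drop (length p) w" "length p \<le> length w" by auto
    then show "q \<in> (\<lambda>i. drop i w) ` {..length w}" by blast
  qed
  then have "finite ?Q" using finite_surj by blast
  moreover have "w = take 1 w @ drop 1 w" "take 1 w \<noteq> []" "drop 1 w \<noteq> []"
    using assms by auto
  then have "?Q \<noteq> {}" by blast
  ultimately have "min_suffix w \<in> ?Q" unfolding min_suffix_def by (rule Min_in)
  then obtain p where p: "w = p @ min_suffix w" "p \<noteq> []" "min_suffix w \<noteq> []" by blast
  have "min_suffix_rest w = p"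
    unfolding min_suffix_rest_def using arg_cong[OF p(1), of length] p(1)
    by (metis add_diff_cancel_right' append_eq_conv_conj length_append)
  then show "w = min_suffix_rest w @ min_suffix w"
    "min_suffix_rest w \<noteq> []" "min_suffix w \<noteq> []"
    using p by auto
qed

function lyndon_bracket :: "nat list \<Rightarrow> 'a::comm_ring_1 ncseries" where
  "lyndon_bracket w =
     (if length w \<le> 1 then word_series w
      else lie_bracket (lyndon_bracket (min_suffix_rest w)) (lyndon_bracket (min_suffix w)))"
  by pat_completeness auto
termination
proof (relation "measure length")
  fix w :: "nat list" assume "\<not> length w \<le> 1"
  then have "2 \<le> length w" by simp
  note * = min_suffix[OF this]
  have "length w = length (min_suffix_rest w) + length (min_suffix w)"
    using arg_cong[OF *(1), of length] by simp
  moreover have "0 < length (min_suffix_rest w)" "0 < length (min_suffix w)"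
    using * by auto
  ultimately show "(min_suffix_rest w, w) \<in> measure length"
    "(min_suffix w, w) \<in> measure length" by auto
qed auto

declare lyndon_bracket.simps [simp del]

definition lyndon_comb :: "nat \<Rightarrow> nat \<Rightarrow> (nat list \<Rightarrow> complex) \<Rightarrow> complex ncseries" where
  "lyndon_comb d m x = (\<lambda>u. \<Sum>w\<in>lyndon_words d m. x w * lyndon_bracket w u)"

section \<open>Polynomials, affine and projective varieties\<close>

text \<open>
  A monomial in variables of type \<open>'i\<close> is a multiset of variables; a polynomial is a
  finitely supported function from monomials to coefficients.  For an index set \<open>I\<close>,
  the space \<open>\<complex>\<^sup>I\<close> is represented by the functions vanishing outside \<open>I\<close>.
\<close>

type_synonym 'i cpoly = "'i multiset \<Rightarrow>\<^sub>0 complex"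

definition eval_monom :: "('i \<Rightarrow> complex) \<Rightarrow> 'i multiset \<Rightarrow> complex" where
  "eval_monom x M = (\<Prod>i\<in>#M. x i)"

definition eval_poly :: "('i \<Rightarrow> complex) \<Rightarrow> 'i cpoly \<Rightarrow> complex" where
  "eval_poly x h = (\<Sum>M\<in>Poly_Mapping.keys h. Poly_Mapping.lookup h M * eval_monom x M)"

definition poly_in :: "'i set \<Rightarrow> 'i cpoly \<Rightarrow> bool" where
  "poly_in I h \<longleftrightarrow> (\<forall>M\<in>Poly_Mapping.keys h. set_mset M \<subseteq> I)"

definition homogeneous :: "nat \<Rightarrow> 'i cpoly \<Rightarrow> bool" where
  "homogeneous n h \<longleftrightarrow> (\<forall>M\<in>Poly_Mapping.keys h. size M = n)"

definition coord_space :: "'i set \<Rightarrow> ('i \<Rightarrow> complex) set" where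
  "coord_space I = {v. \<forall>i. i \<notin> I \<longrightarrow> v i = 0}"

definition linear_automorphism ::
    "'i set \<Rightarrow> (('i \<Rightarrow> complex) \<Rightarrow> ('i \<Rightarrow> complex)) \<Rightarrow> bool" where
  "linear_automorphism I L \<longleftrightarrow>
     bij_betw L (coord_space I) (coord_space I) \<and>
     (\<forall>u\<in>coord_space I. \<forall>v\<in>coord_space I. L (\<lambda>i. u i + v i) = (\<lambda>i. L u i + L v i)) \<and>
     (\<forall>c. \<forall>v\<in>coord_space I. L (\<lambda>i. c * v i) = (\<lambda>i. c * L v i))"

definition zariski_closure :: "'i set \<Rightarrow> ('i \<Rightarrow> complex) set \<Rightarrow> ('i \<Rightarrow> complex) set" where
  "zariski_closure I S =
     {v \<in> coord_space I. \<forall>h. poly_in I h \<and> (\<forall>s\<in>S. eval_poly s h = 0) \<longrightarrow> eval_poly v h = 0}"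

text \<open>
  A point of the projective space over \<open>\<complex>\<^sup>I\<close> is the set of all its vectors of homogeneous
  coordinates.
\<close>

definition proj_point :: "('i \<Rightarrow> complex) \<Rightarrow> ('i \<Rightarrow> complex) set" where
  "proj_point v = {\<lambda>i. c * v i | c. c \<noteq> 0}"

definition projectivization :: "('i \<Rightarrow> complex) set \<Rightarrow> ('i \<Rightarrow> complex) set set" where
  "projectivization X = proj_point ` (X - {\<lambda>_. 0})"

definition proj_space :: "'i set \<Rightarrow> ('i \<Rightarrow> complex) set set" where
  "proj_space I = projectivization (coord_space I)"

definition proj_closure :: "'i set \<Rightarrow> ('i \<Rightarrow> complex) set set \<Rightarrow> ('i \<Rightarrow> complex) set set" where
  "proj_closure I S =
     {p \<in> proj_space I. \<forall>n h. poly_in I h \<and> homogeneous n h \<and>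
        (\<forall>q\<in>S. \<forall>v\<in>q. eval_poly v h = 0) \<longrightarrow> (\<forall>v\<in>p. eval_poly v h = 0)}"

definition proj_open :: "'i set \<Rightarrow> ('i \<Rightarrow> complex) set set \<Rightarrow> bool" where
  "proj_open I U \<longleftrightarrow>
     U \<subseteq> proj_space I \<and> proj_closure I (proj_space I - U) = proj_space I - U"

text \<open>
  A morphism is locally of the form \<open>[v] \<mapsto> [F\<^sub>j(v)]\<^sub>j\<close> with homogeneous polynomials \<open>F\<^sub>j\<close> of
  a common degree and without common zero.
\<close>

definition proj_morphism ::
    "'i set \<Rightarrow> ('i \<Rightarrow> complex) set set \<Rightarrow> 'j set \<Rightarrow> ('j \<Rightarrow> complex) set set \<Rightarrow>
     (('i \<Rightarrow> complex) set \<Rightarrow> ('j \<Rightarrow> complex) set) \<Rightarrow> bool" where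
  "proj_morphism I X J Y \<phi> \<longleftrightarrow>
     \<phi> ` X \<subseteq> Y \<and>
     (\<forall>p\<in>X. \<exists>U n F. proj_open I U \<and> p \<in> U \<and>
        (\<forall>j\<in>J. poly_in I (F j) \<and> homogeneous n (F j)) \<and>
        (\<forall>q\<in>X \<inter> U. \<forall>v\<in>q. (\<exists>j\<in>J. eval_poly v (F j) \<noteq> 0) \<and>
           \<phi> q = proj_point (\<lambda>j. if j \<in> J then eval_poly v (F j) else 0)))"

definition proj_isomorphic ::
    "'i set \<Rightarrow> ('i \<Rightarrow> complex) set set \<Rightarrow> 'j set \<Rightarrow> ('j \<Rightarrow> complex) set set \<Rightarrow> bool" where
  "proj_isomorphic I X J Y \<longleftrightarrow>
     (\<exists>\<phi> \<psi>. proj_morphism I X J Y \<phi> \<and> proj_morphism J Y I X \<psi> \<and>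
        (\<forall>p\<in>X. \<psi> (\<phi> p) = p) \<and> (\<forall>q\<in>Y. \<phi> (\<psi> q) = q))"

text \<open>
  The image of the map \<open>x \<mapsto> [x\<^bsup>e i\<^esup>]\<^sub>i\<close> into projective space, which is defined at those
  \<open>x\<close> for which some coordinate monomial is nonzero.
\<close>

definition monomial_image ::
    "'i set \<Rightarrow> ('i \<Rightarrow> 'v multiset) \<Rightarrow> ('i \<Rightarrow> complex) set set" where
  "monomial_image I e =
     projectivization (range (\<lambda>x i. if i \<in> I then eval_monom x (e i) else 0))"

text \<open>
  Monomials may be repeated.  No zero coordinates are needed: a linear change of coordinates
  turns a zero coordinate into a repeated monomial.
\<close>

definition toric :: "'i set \<Rightarrow> ('i \<Rightarrow> complex) set set \<Rightarrow> bool" where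
  "toric I X \<longleftrightarrow>
     (\<exists>L (e :: 'i \<Rightarrow> nat multiset). linear_automorphism I L \<and>
        (\<lambda>p. L ` p) ` X = proj_closure I (monomial_image I e))"

section \<open>The Rough Veronese variety\<close>

text \<open>
  The exponential is given by the same polynomials over the reals and over the complex
  numbers, so the complexified map is the complex exponential on \<open>lie_upto_complex d m\<close>.
\<close>

definition rough_veronese_map :: "nat \<Rightarrow> complex ncseries \<Rightarrow> complex ncseries" where
  "rough_veronese_map k T = tensor_proj k (tensor_exp T)"

definition rough_veronese :: "nat \<Rightarrow> nat \<Rightarrow> nat \<Rightarrow> complex ncseries set set" where
  "rough_veronese d k m =
     projectivization
       (zariski_closure (words d k) (rough_veronese_map k ` lie_upto_complex d m))"

definition weighted_monomials :: "nat \<Rightarrow> nat \<Rightarrow> nat \<Rightarrow> nat list multiset set" where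
  "weighted_monomials d k m =
     {M. set_mset M \<subseteq> lyndon_words d m \<and> (\<Sum>w\<in>#M. length w) = k}"

end

theory Submission
  imports Defs "HOL-Library.Function_Algebras" "HOL-Library.Countable"
begin

text \<open>
  Let \<open>J\<close> be the set of monomials of weighted degree \<open>k\<close> and \<open>P\<^sub>w\<close> the bracketing of the
  Lyndon word \<open>w\<close>.  Expanding the exponential of \<open>\<Sum>\<^sub>w x\<^sub>w P\<^sub>w\<close> and collecting the terms with
  the same monomial shows that its part of degree \<open>k\<close> is \<open>\<Sum>\<^sub>M x\<^sup>M V\<^sub>M\<close> with \<open>M\<close> in \<open>J\<close>, where
  \<open>V\<^sub>M\<close> is \<open>1 / r!\<close> times the sum of the products \<open>P\<^sub>w\<^sub>1 \<cdots> P\<^sub>w\<^sub>r\<close> over all distinct orderings of the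
  multiset \<open>M\<close> (\<open>rough_veronese_map_lyndon_comb\<close>).  The theorem therefore rests on the linear
  independence of the \<open>V\<^sub>M\<close> (\<open>sym_bracket_prod_independent\<close>): an automorphism that sends them to
  distinct unit vectors turns the map into the list of all monomials in \<open>J\<close>.

  Independence follows from the comparison with products in one fixed order.  The smallest word
  that occurs in \<open>P\<^sub>w\<close> is \<open>w\<close>, so the smallest word in a product of brackets is the concatenation
  of the factors.  For the product in nonincreasing order this is a word together with its Lyndon
  factorization, which is unique; hence these ordered products have different smallest words
  and are independent.  The smallest word of \<open>V\<^sub>M\<close> is not so easily separated from the others, but
  exchanging two neighbours in a product changes it by a combination of products with one factor
  fewer, since \<open>[P\<^sub>u, P\<^sub>v]\<close> is a combination of bracketings \<open>P\<^sub>w\<close> with \<open>|w| = |u| + |v|\<close>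
  (\<open>lie_bracket_lyndon\<close>).  By induction on the number of factors each product is in the span of
  the \<open>V\<^sub>M\<close>.  So the \<open>V\<^sub>M\<close> are as many vectors as the ordered products and span them: they
  are independent.  These brackets leave the words of length at most \<open>m\<close>, so the argument is made
  for \<open>m = k\<close>, where the family is largest, and the other families are subfamilies of that one.

  The rule for \<open>[P\<^sub>u, P\<^sub>v]\<close> also shows that the \<open>P\<^sub>w\<close> span the free Lie algebra, so that the
  vectors \<open>\<Sum>\<^sub>w x\<^sub>w P\<^sub>w\<close> exhaust the complexified space \<open>lie_upto_complex d m\<close>.

  For the projective statements, \<open>z \<mapsto> \<Sum>\<^sub>M z\<^sub>M V\<^sub>M\<close> is a linear embedding with a linear left inverse,
  and such maps commute with Zariski closure and induce isomorphisms of projective varieties.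
  The set of vectors of monomials is a cone, because scaling \<open>x\<^sub>w\<close> by \<open>t\<^bsup>|w|\<^esup>\<close> scales the vector by
  \<open>t\<^sup>k\<close>; for a cone the projective closure is the projectivization of the affine one.  Toricity
  follows with the automorphism that repeats one monomial in all coordinates that would
  otherwise be zero.
\<close>

section \<open>Spaces of functions as vector spaces\<close>

interpretation fun_space: vector_space "\<lambda>(c::'a::field) (f::'b \<Rightarrow> 'a) u. c * f u"
  by unfold_locales (auto simp: fun_eq_iff algebra_simps)

lemma sum_fun_apply: "(\<Sum>i\<in>A. f i) u = (\<Sum>i\<in>A. f i u)"
  for f :: "'i \<Rightarrow> 'b \<Rightarrow> 'a::comm_monoid_add"
  by (induction A rule: infinite_finite_induct) auto

text \<open>
  Membership in a span is checked on generators.  The map is given by its two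
  linearity equations, which hold for the bilinear operations below with one argument fixed.
\<close>

lemma span_linear_image:
  fixes F :: "('b \<Rightarrow> 'a::field) \<Rightarrow> ('c \<Rightarrow> 'a)"
  assumes add: "\<And>S T. F (S + T) = F S + F T"
    and scale: "\<And>c S. F (\<lambda>u. c * S u) = (\<lambda>u. c * F S u)"
    and gen: "\<And>S. S \<in> A \<Longrightarrow> F S \<in> fun_space.span B"
    and X: "X \<in> fun_space.span A"
  shows "F X \<in> fun_space.span B"
proof -
  have "fun_space.subspace {X. F X \<in> fun_space.span B}"
    unfolding fun_space.subspace_def mem_Collect_eq
  proof (intro conjI ballI allI impI)
    have "F 0 = 0"
      using add[of 0 0] by simp
    then show "F 0 \<in> fun_space.span B" using fun_space.span_zero by metis
  qed (simp_all only: add scale mem_Collect_eq fun_space.span_add fun_space.span_scale)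
  then show ?thesis
    using fun_space.span_induct[OF X, of "\<lambda>X. F X \<in> fun_space.span B"] gen by auto
qed

lemma span_diff_trans:
  fixes A B C :: "'b \<Rightarrow> 'a::field"
  assumes "A - B \<in> fun_space.span S" "B - C \<in> fun_space.span S"
  shows "A - C \<in> fun_space.span S"
proof -
  have "(A - B) + (B - C) \<in> fun_space.span S" using assms by (rule fun_space.span_add)
  also have "(A - B) + (B - C) = A - C" by (rule ext) simp
  finally show ?thesis .
qed

text \<open>
  In a vanishing combination, evaluate at the least \<open>l i\<close> among the members with nonzero
  coefficient: all others of them vanish there.
\<close>

lemma independent_if_triangular:
  fixes f :: "'i \<Rightarrow> 'b::linorder \<Rightarrow> 'a::field"
  assumes diag: "\<And>i. i \<in> I \<Longrightarrow> f i (l i) \<noteq> 0"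
    and below: "\<And>i j. i \<in> I \<Longrightarrow> j \<in> I \<Longrightarrow> f j (l i) \<noteq> 0 \<Longrightarrow> l j \<le> l i"
    and inj: "inj_on l I"
  shows "inj_on f I" "fun_space.independent (f ` I)"
proof -
  show inj_f: "inj_on f I"
  proof (rule inj_onI)
    fix i j assume ij: "i \<in> I" "j \<in> I" "f i = f j"
    then have "l i = l j" using below[of i j] below[of j i] diag[of i] diag[of j] by simp
    then show "i = j" using inj ij by (simp add: inj_on_eq_iff)
  qed
  show "fun_space.independent (f ` I)"
    unfolding fun_space.independent_explicit_finite_subsets
  proof (intro allI impI ballI)
    fix S c v
    assume S: "S \<subseteq> f ` I" "finite S" and zero: "(\<Sum>v\<in>S. (\<lambda>u. c v * v u)) = 0" and v: "v \<in> S"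
    obtain K where K: "K \<subseteq> I" "S = f ` K" using S by (metis subset_imageE)
    have inj_K: "inj_on f K" using inj_f K by (metis inj_on_subset)
    have fin: "finite K" using S K inj_K by (metis finite_imageD)
    have zero: "(\<Sum>i\<in>K. c (f i) * f i u) = 0" for u
    proof -
      have "(\<Sum>i\<in>K. c (f i) * f i u) = (\<Sum>v\<in>S. (\<lambda>u. c v * v u)) u"
        unfolding sum_fun_apply K using inj_K by (simp add: sum.reindex)
      then show ?thesis using zero by simp
    qed
    let ?N = "{i \<in> K. c (f i) \<noteq> 0}"
    have "?N = {}"
    proof (rule ccontr)
      assume "?N \<noteq> {}"
      moreover have "finite ?N" using fin by simp
      ultimately obtain i where i: "i \<in> ?N" "\<And>j. j \<in> ?N \<Longrightarrow> l i \<le> l j"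
        by (metis (no_types, lifting) arg_min_least arg_min_if_finite(1))
      have "c (f j) * f j (l i) = 0" if j: "j \<in> K - {i}" for j
      proof (rule ccontr)
        assume nz: "c (f j) * f j (l i) \<noteq> 0"
        then have "j \<in> ?N" using j by auto
        then have "l i \<le> l j" by (rule i(2))
        moreover have "l j \<le> l i" using below[of i j] nz i j K by auto
        ultimately have "l i = l j" by simp
        then show False using inj i j K by (auto simp: inj_on_def)
      qed
      then have "(\<Sum>j\<in>K - {i}. c (f j) * f j (l i)) = 0" by (rule sum.neutral[OF ballI])
      then have "(\<Sum>j\<in>K. c (f j) * f j (l i)) = c (f i) * f i (l i)"
        using i(1) fin by (simp add: sum.remove[of K i])
      then show False using zero[of "l i"] diag[of i] i K by auto
    qed
    then show "c v = 0" using v K by auto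
  qed
qed

text \<open>
  By the exchange lemma a set whose span contains \<open>|I|\<close> independent vectors has at least \<open>|I|\<close>
  elements, so the members of \<open>g\<close> are distinct and none of them can be omitted.
\<close>

lemma independent_if_spans_independent:
  fixes f g :: "'i \<Rightarrow> 'b \<Rightarrow> 'a::field"
  assumes fin: "finite I" and inj: "inj_on f I" and indep: "fun_space.independent (f ` I)"
    and span: "f ` I \<subseteq> fun_space.span (g ` I)"
  shows "inj_on g I" "fun_space.independent (g ` I)"
proof -
  have bound: "card I \<le> card T" if "finite T" "f ` I \<subseteq> fun_space.span T" for T
    using fun_space.independent_span_bound[OF that(1) indep that(2)] card_image[OF inj] by simp
  have card: "card (g ` I) = card I"
    using bound[of "g ` I"] span fin card_image_le[OF fin, of g] by simp
  then show "inj_on g I" using fin by (simp add: eq_card_imp_inj_on)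
  show "fun_space.independent (g ` I)"
  proof
    assume "fun_space.dependent (g ` I)"
    then obtain a where a: "a \<in> g ` I" "a \<in> fun_space.span (g ` I - {a})"
      unfolding fun_space.dependent_def by blast
    then have "fun_space.span (g ` I) = fun_space.span (g ` I - {a})"
      using fun_space.span_redundant[of a "g ` I - {a}"] by (simp add: insert_absorb)
    then have "card I \<le> card (g ` I - {a})" using bound[of "g ` I - {a}"] span fin by simp
    moreover have "card (g ` I - {a}) < card (g ` I)"
      using a fin by (intro card_Diff1_less) auto
    ultimately show False using card by simp
  qed
qed

section \<open>The tensor algebra\<close>

text \<open>
  Both sides are sums over the factorizations of \<open>u\<close> into three words.
\<close>

lemma tensor_mult_assoc:
  "tensor_mult (tensor_mult S T) R = tensor_mult S (tensor_mult T R)"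
proof
  fix u :: "nat list"
  let ?n = "length u"
  let ?g = "\<lambda>j l. S (take j u) * T (take l (drop j u)) * R (drop (j + l) u)"
  have "tensor_mult (tensor_mult S T) R u =
      (\<Sum>i\<le>?n. \<Sum>j\<le>i. S (take j (take i u)) * T (drop j (take i u)) * R (drop i u))"
    unfolding tensor_mult_def sum_distrib_right by (intro sum.cong) auto
  also have "\<dots> = (\<Sum>i\<le>?n. \<Sum>j\<le>i. ?g j (i - j))"
    by (intro sum.cong refl) (auto simp: drop_take min_def)
  also have "\<dots> = (\<Sum>(j, l)\<in>{(j, l). j + l \<le> ?n}. ?g j l)"
    by (rule sum.triangle_reindex_eq[symmetric])
  also have "{(j, l). j + l \<le> ?n} = (SIGMA j:{..?n}. {..?n - j})"
    by auto
  also have "(\<Sum>(j, l)\<in>(SIGMA j:{..?n}. {..?n - j}). ?g j l) =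
      (\<Sum>j\<le>?n. \<Sum>l\<le>?n - j. ?g j l)"
    by (subst sum.Sigma) auto
  also have "\<dots> = tensor_mult S (tensor_mult T R) u"
    by (simp add: tensor_mult_def sum_distrib_left mult.assoc add.commute)
  finally show "tensor_mult (tensor_mult S T) R u = tensor_mult S (tensor_mult T R) u" .
qed

lemma tensor_mult_simps:
  "tensor_mult (S + S') T = tensor_mult S T + tensor_mult S' T"
  "tensor_mult S (T + T') = tensor_mult S T + tensor_mult S T'"
  "tensor_mult (S - S') T = tensor_mult S T - tensor_mult S' T"
  "tensor_mult S (T - T') = tensor_mult S T - tensor_mult S T'"
  "tensor_mult (\<lambda>u. c * S u) T = (\<lambda>u. c * tensor_mult S T u)"
  "tensor_mult S (\<lambda>u. c * T u) = (\<lambda>u. c * tensor_mult S T u)"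
  by (auto simp: tensor_mult_def fun_eq_iff algebra_simps sum.distrib sum_subtractf sum_distrib_left)

lemma tensor_mult_sum_left: "tensor_mult (\<Sum>i\<in>I. S i) T = (\<Sum>i\<in>I. tensor_mult (S i) T)"
  by (rule ext) (simp only: tensor_mult_def sum_fun_apply sum_distrib_right, rule sum.swap)

lemma tensor_mult_sum_right: "tensor_mult S (\<Sum>i\<in>I. T i) = (\<Sum>i\<in>I. tensor_mult S (T i))"
  by (rule ext) (simp only: tensor_mult_def sum_fun_apply sum_distrib_left, rule sum.swap)

lemma tensor_mult_Nil_left [simp]: "tensor_mult (word_series []) T = T"
proof
  fix u
  have "tensor_mult (word_series []) T u = (\<Sum>i\<le>length u. if i = 0 then T u else 0)"
    unfolding tensor_mult_def word_series_def by (intro sum.cong) auto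
  then show "tensor_mult (word_series []) T u = T u" by simp
qed

lemma lie_bracket_eq: "lie_bracket S T = tensor_mult S T - tensor_mult T S"
  by (auto simp: lie_bracket_def fun_eq_iff)

lemma lie_bracket_linear:
  "lie_bracket (S + S') T = lie_bracket S T + lie_bracket S' T"
  "lie_bracket S (T + T') = lie_bracket S T + lie_bracket S T'"
  "lie_bracket (\<lambda>u. c * S u) T = (\<lambda>u. c * lie_bracket S T u)"
  "lie_bracket S (\<lambda>u. c * T u) = (\<lambda>u. c * lie_bracket S T u)"
  by (auto simp: lie_bracket_eq tensor_mult_simps algebra_simps fun_eq_iff)

lemma lie_bracket_self [simp]: "lie_bracket S S = 0"
  by (simp add: lie_bracket_eq)

lemma lie_bracket_swap: "lie_bracket T S = - lie_bracket S T"
  by (simp add: lie_bracket_eq)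

lemma lie_bracket_jacobi:
  "lie_bracket (lie_bracket S T) R =
     lie_bracket (lie_bracket S R) T + lie_bracket S (lie_bracket T R)"
  by (simp add: lie_bracket_eq tensor_mult_simps tensor_mult_assoc)

section \<open>Leading words\<close>

lemma append_less_same_prefix [simp]: "p @ q < p @ q' \<longleftrightarrow> q < q'"
  for p q q' :: "nat list"
  by (induction p) auto

lemma append_le_mono_same_length:
  "length p = length p' \<Longrightarrow> p \<le> p' \<Longrightarrow> q \<le> q' \<Longrightarrow> p @ q \<le> p' @ q'"
  for p q p' q' :: "nat list"
  by (induction p p' rule: list_induct2) auto

lemma less_append [simp]: "p < p @ q \<longleftrightarrow> q \<noteq> []"
  for p q :: "nat list"
  proof (induction p)
  case Nil
  show ?case by (cases q) auto
qed simp

lemma le_append [simp]: "p \<le> p @ q"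
  for p q :: "nat list"
  by (induction p) auto

text \<open>
  A strict inequality of words is decided either by a letter, and then survives any
  extension on both sides, or by length alone.
\<close>

lemma less_imp_prefix_or_append_less:
  fixes p q :: "nat list"
  assumes "p < q"
  shows "(\<exists>t. t \<noteq> [] \<and> q = p @ t) \<or> (\<forall>s t. p @ s < q @ t)"
  using assms
proof (induction p arbitrary: q)
  case Nil
  then show ?case by (cases q) auto
next
  case (Cons a p)
  then obtain b q' where q: "q = b # q'" by (cases q) auto
  show ?case
  proof (cases "a < b")
    case True
    then show ?thesis using q by simp
  next
    case False
    then have "a = b" "p < q'" using Cons.prems q by auto
    then show ?thesis using Cons.IH[of q'] q by simp
  qed
qed

text \<open>
  The length condition makes leading words multiplicative: among words of equal length the order is
  decided by a letter, and so it is preserved by extensions on both sides.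
\<close>

definition leads_with :: "nat list \<Rightarrow> 'a::comm_ring_1 ncseries \<Rightarrow> bool" where
  "leads_with w T \<longleftrightarrow> T w = 1 \<and> (\<forall>u. T u \<noteq> 0 \<longrightarrow> length u = length w \<and> w \<le> u)"

lemma leads_withD: "leads_with w T \<Longrightarrow> T u \<noteq> 0 \<Longrightarrow> length u = length w \<and> w \<le> u"
  unfolding leads_with_def by blast

lemma leads_with_self: "leads_with w T \<Longrightarrow> T w = 1"
  by (simp add: leads_with_def)

lemma leads_with_word_series: "leads_with w (word_series w)"
  by (auto simp: leads_with_def word_series_def)

lemma leads_with_tensor_mult:
  assumes S: "leads_with p S" and T: "leads_with q T"
  shows "leads_with (p @ q) (tensor_mult S T)"
  unfolding leads_with_def
proof (intro conjI allI impI)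
  have "tensor_mult S T (p @ q) = (\<Sum>i\<le>length (p @ q). if i = length p then 1 else 0)"
    unfolding tensor_mult_def
  proof (intro sum.cong refl)
    fix i assume i: "i \<in> {..length (p @ q)}"
    show "S (take i (p @ q)) * T (drop i (p @ q)) = (if i = length p then 1 else 0)"
    proof (cases "i = length p")
      case True
      then show ?thesis using leads_with_self[OF S] leads_with_self[OF T] by simp
    next
      case False
      have "S (take i (p @ q)) = 0"
        using leads_withD[OF S, of "take i (p @ q)"] i False
        by (metis atMost_iff length_take min.absorb2)
      then show ?thesis using False by simp
    qed
  qed
  also have "\<dots> = 1" by simp
  finally show "tensor_mult S T (p @ q) = 1" .
next
  fix u assume "tensor_mult S T u \<noteq> 0"
  then obtain i where i: "i \<le> length u" "S (take i u) * T (drop i u) \<noteq> 0"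
    unfolding tensor_mult_def by (meson atMost_iff sum.neutral)
  then have S': "S (take i u) \<noteq> 0" and T': "T (drop i u) \<noteq> 0" by auto
  note leads_withD[OF S S'] leads_withD[OF T T']
  then show "length u = length (p @ q)" "p @ q \<le> u"
    using append_le_mono_same_length[of p "take i u" q "drop i u"] i by auto
qed

section \<open>Lyndon words\<close>

lemma lyndonD: "lyndon w \<Longrightarrow> w = p @ q \<Longrightarrow> p \<noteq> [] \<Longrightarrow> q \<noteq> [] \<Longrightarrow> w < q"
  unfolding lyndon_def by blast

lemma lyndon_suffix_le: "lyndon w \<Longrightarrow> w = p @ q \<Longrightarrow> q \<noteq> [] \<Longrightarrow> w \<le> q"
  using lyndonD[of w p q] by (cases "p = []") auto

lemma finite_proper_suffixes: "finite {q. \<exists>p. w = p @ q \<and> p \<noteq> [] \<and> q \<noteq> []}"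
proof (rule finite_subset)
  show "{q. \<exists>p. w = p @ q \<and> p \<noteq> [] \<and> q \<noteq> []} \<subseteq> (\<lambda>i. drop i w) ` {..length w}"
  proof
    fix q assume "q \<in> {q. \<exists>p. w = p @ q \<and> p \<noteq> [] \<and> q \<noteq> []}"
    then obtain p where "w = p @ q" by auto
    then have "q = drop (length p) w" "length p \<le> length w" by auto
    then show "q \<in> (\<lambda>i. drop i w) ` {..length w}" by blast
  qed
qed auto

lemma min_suffix_le: "w = p @ q \<Longrightarrow> p \<noteq> [] \<Longrightarrow> q \<noteq> [] \<Longrightarrow> min_suffix w \<le> q"
  unfolding min_suffix_def by (rule Min_le[OF finite_proper_suffixes]) auto

lemma min_suffix_eqI:
  assumes "w = p @ q" "p \<noteq> []" "q \<noteq> []"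
    and "\<And>a b. w = a @ b \<Longrightarrow> a \<noteq> [] \<Longrightarrow> b \<noteq> [] \<Longrightarrow> q \<le> b"
  shows "min_suffix w = q" "min_suffix_rest w = p"
proof -
  show "min_suffix w = q"
    unfolding min_suffix_def using assms by (intro Min_eqI finite_proper_suffixes) auto
  then show "min_suffix_rest w = p"
    unfolding min_suffix_rest_def using assms(1) by simp
qed

lemma lyndon_min_suffix:
  assumes w: "lyndon w" and len: "2 \<le> length w"
  shows "lyndon (min_suffix w)"
  unfolding lyndon_def
proof (intro conjI allI impI)
  note f = min_suffix[OF len]
  show "min_suffix w \<noteq> []" by (rule f)
  fix a b assume ab: "min_suffix w = a @ b \<and> a \<noteq> [] \<and> b \<noteq> []"
  then have "w = (min_suffix_rest w @ a) @ b" using f(1) by simp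
  from min_suffix_le[OF this] have "min_suffix w \<le> b" using ab by blast
  moreover have "min_suffix w \<noteq> b" using ab by auto
  ultimately show "min_suffix w < b" by simp
qed

text \<open>
  Let \<open>w = p q\<close> with minimal proper suffix \<open>q\<close>, and \<open>p = a b\<close>.  If \<open>b < p\<close> is decided at a letter
  of \<open>b\<close>, then \<open>b q < p q = w\<close>, although \<open>b q\<close> is a proper suffix of the Lyndon word \<open>w\<close>.  Otherwise
  \<open>p = b c\<close>, and \<open>b c q = w < b q\<close> gives the suffix \<open>c q < q\<close>, against the minimality of \<open>q\<close>.
\<close>

lemma lyndon_min_suffix_rest:
  assumes w: "lyndon w" and len: "2 \<le> length w"
  shows "lyndon (min_suffix_rest w)"
  unfolding lyndon_def
proof (intro conjI allI impI)
  note f = min_suffix[OF len]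
  let ?p = "min_suffix_rest w" and ?q = "min_suffix w"
  show "?p \<noteq> []" by (rule f)
  fix a b assume ab: "?p = a @ b \<and> a \<noteq> [] \<and> b \<noteq> []"
  have wab: "w = a @ (b @ ?q)" using f(1) ab by simp
  show "?p < b"
  proof (rule ccontr)
    assume "\<not> ?p < b"
    moreover have "?p \<noteq> b" using ab by auto
    ultimately have "b < ?p" by simp
    then consider c where "c \<noteq> []" "?p = b @ c" | "\<And>s t. b @ s < ?p @ t"
      using less_imp_prefix_or_append_less by blast
    then show False
    proof cases
      case 1
      have wbc: "w = b @ (c @ ?q)" using f(1) 1 by simp
      have "w < b @ ?q" using lyndonD[OF w wab] ab f by simp
      then have "c @ ?q < ?q" using wbc by (metis append_less_same_prefix)
      moreover have "?q \<le> c @ ?q" using min_suffix_le[OF wbc] ab f by simp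
      ultimately show False by simp
    next
      case 2
      have "b @ ?q < w" using 2[of ?q ?q] f(1) by simp
      moreover have "w < b @ ?q" using lyndonD[OF w wab] ab f by simp
      ultimately show False by simp
    qed
  qed
qed

lemma lyndon_less_min_suffix: "lyndon w \<Longrightarrow> 2 \<le> length w \<Longrightarrow> w < min_suffix w"
  using min_suffix[of w] lyndonD by blast

lemma lyndon_append_less:
  assumes u: "lyndon u" and v: "lyndon v" and uv: "u < v"
  shows "u @ v < v"
proof -
  consider t where "t \<noteq> []" "v = u @ t" | "\<And>s t. u @ s < v @ t"
    using less_imp_prefix_or_append_less[OF uv] by blast
  then show ?thesis
  proof cases
    case 1
    have "u \<noteq> []" using u by (simp add: lyndon_def)
    then have "v < t" using lyndonD[OF v] 1 by blast
    then show ?thesis using 1(2) append_less_same_prefix[of u v t] by simp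
  next
    case 2
    show ?thesis using 2[of v "[]"] by simp
  qed
qed

text \<open>
  A suffix \<open>s v\<close> with \<open>s\<close> a proper suffix of \<open>u\<close> satisfies \<open>u < s\<close>, and since \<open>s\<close> is shorter than
  \<open>u\<close> the comparison is decided by a letter; so \<open>u v < s v\<close>.
\<close>

lemma lyndon_append:
  assumes u: "lyndon u" and v: "lyndon v" and uv: "u < v"
  shows "lyndon (u @ v)"
  unfolding lyndon_def
proof (intro conjI allI impI)
  have less: "u @ v < v" using assms by (rule lyndon_append_less)
  show "u @ v \<noteq> []" using u by (simp add: lyndon_def)
  fix p q assume pq: "u @ v = p @ q \<and> p \<noteq> [] \<and> q \<noteq> []"
  then consider s where "u = p @ s" "s \<noteq> []" "q = s @ v" | s where "v = s @ q"
    by (auto simp: append_eq_append_conv2) (metis append_Nil append_Nil2)+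
  then show "u @ v < q"
  proof cases
    case 1
    then have "u < s" using lyndonD[OF u] pq by blast
    moreover have "length s < length u" using 1 pq by simp
    then have "\<nexists>t. s = u @ t" by auto
    ultimately have "u @ v < s @ v" using less_imp_prefix_or_append_less by blast
    then show ?thesis using 1 by simp
  next
    case 2
    then have "v \<le> q" using lyndon_suffix_le[OF v] pq by blast
    then show ?thesis using less by simp
  qed
qed

lemma lyndon_bracket_short: "length w \<le> 1 \<Longrightarrow> lyndon_bracket w = word_series w"
  by (subst lyndon_bracket.simps) simp

lemma lyndon_bracket_long:
  "\<not> length w \<le> 1 \<Longrightarrow>
    lyndon_bracket w = lie_bracket (lyndon_bracket (min_suffix_rest w)) (lyndon_bracket (min_suffix w))"
  by (subst lyndon_bracket.simps) simp

lemma length_set_min_suffix: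
  assumes "2 \<le> length w"
  shows "length w = length (min_suffix_rest w) + length (min_suffix w)"
    and "set w = set (min_suffix_rest w) \<union> set (min_suffix w)"
  using arg_cong[OF min_suffix(1)[OF assms], of length] arg_cong[OF min_suffix(1)[OF assms], of set]
  by simp_all

text \<open>
  In \<open>P\<^sub>w = P\<^sub>p P\<^sub>q - P\<^sub>q P\<^sub>p\<close> the first product starts at \<open>p q = w\<close> and the second at \<open>q p\<close>, which is
  larger because \<open>w < q\<close> for a Lyndon word.
\<close>

lemma leads_with_lyndon_bracket: "lyndon w \<Longrightarrow> leads_with w (lyndon_bracket w)"
proof (induction w rule: lyndon_bracket.induct)
  case (1 w)
  let ?P = "lyndon_bracket :: nat list \<Rightarrow> 'a ncseries"
  show ?case
  proof (cases "length w \<le> 1")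
    case True
    then show ?thesis using lyndon_bracket_short leads_with_word_series by metis
  next
    case False
    then have len: "2 \<le> length w" by simp
    note f = min_suffix[OF len]
    let ?p = "min_suffix_rest w" and ?q = "min_suffix w"
    have p: "leads_with ?p (?P ?p)"
      using "1.IH"(1)[OF False lyndon_min_suffix_rest[OF "1.prems" len]] .
    have q: "leads_with ?q (?P ?q)"
      using "1.IH"(2)[OF False lyndon_min_suffix[OF "1.prems" len]] .
    have pq: "leads_with w (tensor_mult (?P ?p) (?P ?q))"
      using leads_with_tensor_mult[OF p q] f(1) by simp
    have qp: "leads_with (?q @ ?p) (tensor_mult (?P ?q) (?P ?p))"
      by (rule leads_with_tensor_mult[OF q p])
    have lt: "w < ?q @ ?p"
      using lyndon_less_min_suffix[OF "1.prems" len] le_append[of ?q ?p] by (rule less_le_trans)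
    have zero: "tensor_mult (?P ?q) (?P ?p) w = 0"
      using leads_withD[OF qp, of w] lt by (meson leD)
    show ?thesis
      unfolding leads_with_def
    proof (intro conjI allI impI)
      show "?P w w = 1"
        using leads_with_self[OF pq] zero by (simp add: lyndon_bracket_long[OF False] lie_bracket_def)
      fix u assume "?P w u \<noteq> 0"
      then have "tensor_mult (?P ?p) (?P ?q) u \<noteq> 0 \<or> tensor_mult (?P ?q) (?P ?p) u \<noteq> 0"
        by (auto simp: lyndon_bracket_long[OF False] lie_bracket_def)
      then show "length u = length w" "w \<le> u"
        using leads_withD[OF pq, of u] leads_withD[OF qp, of u] length_set_min_suffix(1)[OF len] lt
        by auto
    qed
  qed
qed

section \<open>Brackets of Lyndon words span the free Lie algebra\<close>

definition lyndon_over :: "nat \<Rightarrow> nat list set" where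
  "lyndon_over d = {w. lyndon w \<and> set w \<subseteq> {1..d}}"

text \<open>
  The condition says that the factorization into \<open>u\<close> and \<open>v\<close> is the standard one: a proper suffix
  of \<open>u v\<close> that is longer than \<open>v\<close> has the form \<open>s v\<close> with \<open>s \<ge> min_suffix u \<ge> v\<close>.
\<close>

lemma lyndon_bracket_append:
  assumes u: "lyndon u" and v: "lyndon v"
    and std: "length u = 1 \<or> v \<le> min_suffix u"
  shows "lyndon_bracket (u @ v) = lie_bracket (lyndon_bracket u) (lyndon_bracket v)"
proof -
  have ne: "u \<noteq> []" "v \<noteq> []" using u v by (auto simp: lyndon_def)
  have "v \<le> b" if ab: "u @ v = a @ b" "a \<noteq> []" "b \<noteq> []" for a b
  proof -
    from ab(1) consider s where "u = a @ s" "b = s @ v" | s where "v = s @ b"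
      by (auto simp: append_eq_append_conv2)
    then show ?thesis
    proof cases
      case 1
      show ?thesis
      proof (cases "s = []")
        case False
        have "length u \<noteq> 1" using 1 ab False by (cases a; cases s) auto
        then have "v \<le> min_suffix u" using std by simp
        also have "\<dots> \<le> s" using min_suffix_le[of u a s] 1 ab False by simp
        also have "\<dots> \<le> b" using 1 by simp
        finally show ?thesis .
      qed (use 1 in simp)
    next
      case 2
      then show ?thesis using lyndon_suffix_le[OF v] ab by blast
    qed
  qed
  then have eq: "min_suffix (u @ v) = v" "min_suffix_rest (u @ v) = u"
    using min_suffix_eqI[of "u @ v" u v] ne by auto
  have "\<not> length (u @ v) \<le> 1" using ne by (cases u; cases v) auto
  from lyndon_bracket_long[OF this] show ?thesis by (simp add: eq)
qed

text \<open>
  If \<open>u v\<close> is the standard factorization of a Lyndon word, the bracket is \<open>P\<^sub>u\<^sub>v\<close>.  Otherwise \<open>u\<close> has the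
  standard factorization \<open>p q\<close> with \<open>q < v\<close>, and the Jacobi identity
  \<open>[[P\<^sub>p, P\<^sub>q], P\<^sub>v] = [[P\<^sub>p, P\<^sub>v], P\<^sub>q] + [P\<^sub>p, [P\<^sub>q, P\<^sub>v]]\<close> leads to inner brackets of smaller total length,
  which expand into \<open>P\<^sub>w\<close> with \<open>w < v\<close>; the outer brackets then have the same total length
  but both words below \<open>v\<close>.  The bound \<open>w < v\<close> in the conclusion makes this induction on the
  length and then on the larger of the two words possible; it is well-founded because there are
  finitely many words of bounded length over \<open>{1..d}\<close>.
\<close>

lemma lie_bracket_lyndon_less:
  assumes "u \<in> lyndon_over d" "v \<in> lyndon_over d" "u < v" "length u + length v = n"
  shows "(lie_bracket (lyndon_bracket u) (lyndon_bracket v) :: 'a::field ncseries) \<in>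
    fun_space.span (lyndon_bracket ` {w \<in> lyndon_over d. length w = n \<and> w < v})"
  using assms
proof (induction n arbitrary: u v rule: less_induct)
  case (less n)
  let ?P = "lyndon_bracket :: nat list \<Rightarrow> 'a ncseries"
  let ?B = "\<lambda>n v. ?P ` {w \<in> lyndon_over d. length w = n \<and> w < v}"
  let ?smaller = "\<lambda>v. {z. set z \<subseteq> {1..d} \<and> length z \<le> n \<and> z < v}"
  note shorter = less.IH
  show ?case using less.prems
  proof (induction "card (?smaller v)" arbitrary: u v rule: less_induct)
    case less
    have u: "lyndon u" "set u \<subseteq> {1..d}" and v: "lyndon v" "set v \<subseteq> {1..d}"
      using less.prems by (auto simp: lyndon_over_def)
    have "u \<noteq> []" using u by (simp add: lyndon_def)
    \<comment> \<open>the induction hypothesis without the order of the two words, as needed for the outer brackets\<close>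
    have below: "lie_bracket (?P a) (?P b) \<in> fun_space.span (?B n v)"
      if ab: "a \<in> lyndon_over d" "b \<in> lyndon_over d" "a < v" "b < v" "length a + length b = n" for a b
    proof -
      have ordered: "lie_bracket (?P a) (?P b) \<in> fun_space.span (?B n v)"
        if ab: "a \<in> lyndon_over d" "b \<in> lyndon_over d" "a < b" "b < v" "length a + length b = n" for a b
      proof -
        have "finite (?smaller v)"
          by (rule finite_subset[OF _ finite_lists_length_le[of "{1..d}" n]]) auto
        moreover have "b \<in> ?smaller v - ?smaller b" "?smaller b \<subseteq> ?smaller v"
          using ab by (auto simp: lyndon_over_def)
        ultimately have "card (?smaller b) < card (?smaller v)"
          by (intro psubset_card_mono) auto
        then have "lie_bracket (?P a) (?P b) \<in> fun_space.span (?B n b)"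
          using less.hyps ab by blast
        moreover have "?B n b \<subseteq> ?B n v" using ab by auto
        ultimately show ?thesis using fun_space.span_mono by blast
      qed
      consider "a = b" | "a < b" | "b < a" by (rule linorder_cases) auto
      then show ?thesis
      proof cases
        case 1
        then show ?thesis using fun_space.span_zero by simp
      next
        case 2
        then show ?thesis using ordered ab by blast
      next
        case 3
        have "- lie_bracket (?P b) (?P a) \<in> fun_space.span (?B n v)"
          using ordered[of b a] ab 3 by (intro fun_space.span_neg) (simp add: add.commute)
        then show ?thesis by (simp add: lie_bracket_swap[of "?P a" "?P b"])
      qed
    qed
    show ?case
    proof (cases "length u = 1 \<or> v \<le> min_suffix u")
      case True
      have "u @ v \<in> lyndon_over d"
        using lyndon_append[OF u(1) v(1)] less.prems u v by (auto simp: lyndon_over_def)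
      moreover have "u @ v < v" using lyndon_append_less u v less.prems by blast
      moreover have "length (u @ v) = n" using less.prems by simp
      ultimately have "?P (u @ v) \<in> ?B n v" by blast
      then show ?thesis
        unfolding lyndon_bracket_append[OF u(1) v(1) True, symmetric] by (rule fun_space.span_base)
    next
      case False
      then have len: "2 \<le> length u" using \<open>u \<noteq> []\<close> by (cases u) (auto simp: Suc_le_eq)
      let ?p = "min_suffix_rest u" and ?q = "min_suffix u"
      note f = min_suffix[OF len]
      note lens = length_set_min_suffix(1)[OF len]
      have pos: "0 < length ?p" "0 < length ?q" using f(2,3) by simp_all
      have pq: "?p \<in> lyndon_over d" "?q \<in> lyndon_over d"
        using lyndon_min_suffix lyndon_min_suffix_rest u len length_set_min_suffix(2)[OF len]
        by (auto simp: lyndon_over_def)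
      have "?p < u" using f by (metis less_append)
      then have pv: "?p < v" using less.prems by simp
      have qv: "?q < v" using False by (meson not_le)
      have P_u: "?P u = lie_bracket (?P ?p) (?P ?q)"
        using len by (intro lyndon_bracket_long) simp
      have 1: "lie_bracket (?P ?p) (?P v) \<in> fun_space.span (?B (length ?p + length v) v)"
        by (rule shorter[OF _ pq(1) less.prems(2) pv refl]) (use pos lens less.prems(4) in linarith)
      have 2: "lie_bracket (?P ?q) (?P v) \<in> fun_space.span (?B (length ?q + length v) v)"
        by (rule shorter[OF _ pq(2) less.prems(2) qv refl]) (use pos lens less.prems(4) in linarith)
      have "lie_bracket (lie_bracket (?P ?p) (?P v)) (?P ?q) \<in> fun_space.span (?B n v)"
      proof (rule span_linear_image[where F = "\<lambda>X. lie_bracket X (?P ?q)", OF _ _ _ 1])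
        fix S assume "S \<in> ?B (length ?p + length v) v"
        then obtain w where w: "w \<in> lyndon_over d" "length w = length ?p + length v" "w < v" "S = ?P w"
          by blast
        show "lie_bracket S (?P ?q) \<in> fun_space.span (?B n v)"
          unfolding w(4) by (rule below[OF w(1) pq(2) w(3) qv]) (use w(2) less.prems(4) lens in linarith)
      qed (rule lie_bracket_linear)+
      moreover have "lie_bracket (?P ?p) (lie_bracket (?P ?q) (?P v)) \<in> fun_space.span (?B n v)"
      proof (rule span_linear_image[where F = "\<lambda>X. lie_bracket (?P ?p) X", OF _ _ _ 2])
        fix S assume "S \<in> ?B (length ?q + length v) v"
        then obtain w where w: "w \<in> lyndon_over d" "length w = length ?q + length v" "w < v" "S = ?P w"
          by blast
        show "lie_bracket (?P ?p) S \<in> fun_space.span (?B n v)"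
          unfolding w(4) by (rule below[OF pq(1) w(1) pv w(3)]) (use w(2) less.prems(4) lens in linarith)
      qed (rule lie_bracket_linear)+
      ultimately show ?thesis
        unfolding P_u lie_bracket_jacobi[of "?P ?p" "?P ?q" "?P v"] by (rule fun_space.span_add)
    qed
  qed
qed

lemma lie_bracket_lyndon:
  assumes "u \<in> lyndon_over d" "v \<in> lyndon_over d"
  shows "(lie_bracket (lyndon_bracket u) (lyndon_bracket v) :: 'a::field ncseries) \<in>
    fun_space.span (lyndon_bracket ` {w \<in> lyndon_over d. length w = length u + length v})"
    (is "_ \<in> fun_space.span ?B")
proof -
  have ordered: "(lie_bracket (lyndon_bracket a) (lyndon_bracket b) :: 'a ncseries) \<in> fun_space.span ?B"
    if "a \<in> lyndon_over d" "b \<in> lyndon_over d" "a < b" "length a + length b = length u + length v"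
    for a b
    using lie_bracket_lyndon_less[OF that] by (rule set_mp[OF fun_space.span_mono, rotated]) auto
  consider "u = v" | "u < v" | "v < u" by (rule linorder_cases) auto
  then show ?thesis
  proof cases
    case 1
    then show ?thesis using fun_space.span_zero by simp
  next
    case 2
    then show ?thesis using ordered assms by simp
  next
    case 3
    have "- lie_bracket (lyndon_bracket v) (lyndon_bracket u :: 'a ncseries) \<in> fun_space.span ?B"
      using ordered[of v u] assms 3 by (intro fun_space.span_neg) simp
    then show ?thesis by (simp add: lie_bracket_swap[of "lyndon_bracket u"])
  qed
qed

text \<open>
  The span of the \<open>P\<^sub>w\<close> contains the letters and, by bilinearity, is closed under brackets.
\<close>

lemma free_lie_subset_span:
  assumes "T \<in> free_lie d"
  shows "T \<in> fun_space.span (lyndon_bracket ` lyndon_over d)"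
  using assms
proof induction
  case (letter i)
  have "lyndon [i]" by (auto simp: lyndon_def Cons_eq_append_conv)
  then have "[i] \<in> lyndon_over d" using letter by (simp add: lyndon_over_def)
  moreover have "lyndon_bracket [i] = (word_series [i] :: real ncseries)"
    by (rule lyndon_bracket_short) simp
  ultimately have "(word_series [i] :: real ncseries) \<in> lyndon_bracket ` lyndon_over d"
    by (metis imageI)
  then show ?case by (rule fun_space.span_base)
next
  case zero
  then show ?case using fun_space.span_zero by (simp add: zero_fun_def)
next
  case (add S T)
  then show ?case using fun_space.span_add[of S _ T] by (simp add: plus_fun_def)
next
  case (scale T c)
  then show ?case using fun_space.span_scale by blast
next
  case (bracket S T)
  let ?B = "lyndon_bracket ` lyndon_over d :: real ncseries set"
  have gen: "lie_bracket (lyndon_bracket u) (lyndon_bracket v) \<in> fun_space.span ?B"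
    if "u \<in> lyndon_over d" "v \<in> lyndon_over d" for u v
    using lie_bracket_lyndon[OF that] by (rule set_mp[OF fun_space.span_mono, rotated]) auto
  have "lie_bracket S (lyndon_bracket v) \<in> fun_space.span ?B" if "v \<in> lyndon_over d" for v
    by (rule span_linear_image[where F = "\<lambda>X. lie_bracket X (lyndon_bracket v)", OF _ _ _ bracket.IH(1)])
      (use gen that in \<open>auto simp: lie_bracket_linear\<close>)
  then show ?case
    by (intro span_linear_image[where F = "lie_bracket S", OF _ _ _ bracket.IH(2)])
      (auto simp: lie_bracket_linear)
qed

section \<open>Products of brackets\<close>

primrec bracket_prod :: "nat list list \<Rightarrow> 'a::comm_ring_1 ncseries" where
  "bracket_prod [] = word_series []"
| "bracket_prod (w # ws) = tensor_mult (lyndon_bracket w) (bracket_prod ws)"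

lemma bracket_prod_append: "bracket_prod (xs @ ys) = tensor_mult (bracket_prod xs) (bracket_prod ys)"
  by (induction xs) (simp_all add: tensor_mult_assoc)

lemma leads_with_bracket_prod:
  "(\<And>w. w \<in> set ws \<Longrightarrow> lyndon w) \<Longrightarrow> leads_with (concat ws) (bracket_prod ws)"
  by (induction ws)
    (auto intro!: leads_with_word_series leads_with_tensor_mult leads_with_lyndon_bracket)

definition lyndon_lists :: "nat \<Rightarrow> nat \<Rightarrow> nat list list set" where
  "lyndon_lists d n = {ws. set ws \<subseteq> lyndon_over d \<and> length (concat ws) = n}"

text \<open>
  Generators of the filtration of the tensor algebra by the number of Lie factors, in degree \<open>n\<close>.
\<close>

definition shorter_prods :: "nat \<Rightarrow> nat \<Rightarrow> nat \<Rightarrow> 'a::comm_ring_1 ncseries set" where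
  "shorter_prods d n r = bracket_prod ` {ws \<in> lyndon_lists d n. length ws < r}"

text \<open>
  The difference is \<open>\<dots> [P\<^sub>a, P\<^sub>b] \<dots>\<close>, and the bracket in the middle is a combination of single
  factors \<open>P\<^sub>w\<close>.
\<close>

lemma bracket_prod_swap:
  assumes "xs @ a # b # ys \<in> lyndon_lists d n"
  shows "(bracket_prod (xs @ a # b # ys) - bracket_prod (xs @ b # a # ys) :: 'a::field ncseries) \<in>
    fun_space.span (shorter_prods d n (length (xs @ a # b # ys)))"
proof -
  let ?F = "\<lambda>X. tensor_mult (bracket_prod xs) (tensor_mult X (bracket_prod ys)) :: 'a ncseries"
  have ab: "a \<in> lyndon_over d" "b \<in> lyndon_over d"
    using assms by (auto simp: lyndon_lists_def)
  have "?F (lie_bracket (lyndon_bracket a) (lyndon_bracket b)) \<in>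
      fun_space.span (shorter_prods d n (length (xs @ a # b # ys)))"
  proof (rule span_linear_image[where F = ?F, OF _ _ _ lie_bracket_lyndon[OF ab]])
    fix S :: "'a ncseries"
    assume "S \<in> lyndon_bracket ` {w \<in> lyndon_over d. length w = length a + length b}"
    then obtain w where w: "w \<in> lyndon_over d" "length w = length a + length b"
      "S = lyndon_bracket w" by auto
    have "?F S = bracket_prod (xs @ w # ys)" using w by (simp add: bracket_prod_append)
    moreover have "xs @ w # ys \<in> lyndon_lists d n" using assms w by (auto simp: lyndon_lists_def)
    ultimately have "?F S \<in> shorter_prods d n (length (xs @ a # b # ys))"
      by (auto simp: shorter_prods_def)
    then show "?F S \<in> fun_space.span (shorter_prods d n (length (xs @ a # b # ys)))"
      by (rule fun_space.span_base)
  qed (simp_all add: tensor_mult_simps)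
  moreover have "?F (lie_bracket (lyndon_bracket a) (lyndon_bracket b)) =
      bracket_prod (xs @ a # b # ys) - bracket_prod (xs @ b # a # ys)"
    by (simp add: bracket_prod_append lie_bracket_eq tensor_mult_simps tensor_mult_assoc)
  ultimately show ?thesis by simp
qed

lemma bracket_prod_move_to_front:
  assumes "xs @ a # ys \<in> lyndon_lists d n"
  shows "(bracket_prod (xs @ a # ys) - bracket_prod (a # xs @ ys) :: 'a::field ncseries) \<in>
    fun_space.span (shorter_prods d n (length (xs @ a # ys)))"
  using assms
proof (induction xs arbitrary: ys rule: rev_induct)
  case Nil
  then show ?case using fun_space.span_zero by (simp flip: zero_fun_def)
next
  case (snoc x xs)
  have "xs @ x # a # ys \<in> lyndon_lists d n" "xs @ a # x # ys \<in> lyndon_lists d n"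
    using snoc.prems by (auto simp: lyndon_lists_def)
  note span_diff_trans[OF bracket_prod_swap[OF this(1), where 'a = 'a]] snoc.IH[OF this(2)]
  from this(1)[of "bracket_prod (a # xs @ x # ys)"] this(2)
  show ?case by (simp only: append.simps append_assoc list.size length_append add_Suc_right)
qed

text \<open>
  The first factor of \<open>xs\<close> is brought to the front of \<open>ys\<close>, and then the remaining factors are
  compared: one more factor on the left takes shorter products of smaller degree to shorter products.
\<close>

lemma bracket_prod_perm:
  assumes "xs \<in> lyndon_lists d n" "mset xs = mset ys"
  shows "(bracket_prod xs - bracket_prod ys :: 'a::field ncseries) \<in>
    fun_space.span (shorter_prods d n (length xs))"
  using assms
proof (induction xs arbitrary: ys n)
  case Nil
  then show ?case using fun_space.span_zero by (simp flip: zero_fun_def)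
next
  case (Cons a xs)
  have "a \<in> set ys" using Cons.prems(2) by (metis list.set_intros(1) set_mset_mset)
  then obtain l r where ys: "ys = l @ a # r" by (meson split_list)
  then have mset: "mset xs = mset (l @ r)" using Cons.prems by simp
  define n' where "n' = length (concat xs)"
  have a: "a \<in> lyndon_over d" and xs: "xs \<in> lyndon_lists d n'" and n: "n = length a + n'"
    using Cons.prems by (auto simp: lyndon_lists_def n'_def)
  let ?F = "tensor_mult (lyndon_bracket a) :: 'a ncseries \<Rightarrow> 'a ncseries"
  have "?F (bracket_prod xs - bracket_prod (l @ r)) \<in>
      fun_space.span (shorter_prods d n (length (a # xs)))"
  proof (rule span_linear_image[where F = ?F, OF _ _ _ Cons.IH[OF xs mset]])
    fix S :: "'a ncseries" assume "S \<in> shorter_prods d n' (length xs)"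
    then obtain ws where ws: "ws \<in> lyndon_lists d n'" "length ws < length xs" "S = bracket_prod ws"
      by (auto simp: shorter_prods_def)
    then have "a # ws \<in> lyndon_lists d n" "length (a # ws) < length (a # xs)"
      "?F S = bracket_prod (a # ws)"
      using a n by (auto simp: lyndon_lists_def)
    then have "?F S \<in> shorter_prods d n (length (a # xs))" unfolding shorter_prods_def by blast
    then show "?F S \<in> fun_space.span (shorter_prods d n (length (a # xs)))"
      by (rule fun_space.span_base)
  qed (simp_all add: tensor_mult_simps)
  moreover have "?F (bracket_prod xs - bracket_prod (l @ r)) =
      bracket_prod (a # xs) - bracket_prod (a # l @ r)"
    by (simp add: tensor_mult_simps)
  ultimately have front: "bracket_prod (a # xs) - bracket_prod (a # l @ r) \<in>
      fun_space.span (shorter_prods d n (length (a # xs)) :: 'a ncseries set)"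
    by argo
  have "l @ a # r \<in> lyndon_lists d n"
  proof -
    have "set xs = set (l @ r)" "sum_list (map length xs) = sum_list (map length (l @ r))"
      using mset by (metis set_mset_mset, metis mset_map sum_mset_sum_list)
    then show ?thesis using a xs n by (auto simp: lyndon_lists_def length_concat n'_def)
  qed
  from bracket_prod_move_to_front[OF this, where 'a = 'a]
  have "- (bracket_prod (l @ a # r) - bracket_prod (a # l @ r)) \<in>
      fun_space.span (shorter_prods d n (length (l @ a # r)) :: 'a ncseries set)"
    by (rule fun_space.span_neg)
  moreover have "length (l @ a # r) = length (a # xs)"
    using Cons.prems ys by (metis mset_eq_length)
  ultimately have "bracket_prod (a # l @ r) - bracket_prod (l @ a # r) \<in>
      fun_space.span (shorter_prods d n (length (a # xs)) :: 'a ncseries set)"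
    by (simp only: minus_diff_eq)
  from span_diff_trans[OF front this] show ?case unfolding ys .
qed

section \<open>Uniqueness of the Lyndon factorization\<close>

text \<open>
  Every nonempty suffix starts with a suffix \<open>s\<close> of some factor, possibly the whole factor, and
  \<open>s\<close> is at least that factor, hence at least the last one.
\<close>

lemma last_lyndon_factor_le_suffix:
  assumes "sorted_wrt (\<ge>) (xs @ [x])" "\<And>w. w \<in> set (xs @ [x]) \<Longrightarrow> lyndon w"
    and "concat (xs @ [x]) = p @ q" "q \<noteq> []"
  shows "x \<le> q"
  using assms
proof (induction xs arbitrary: p)
  case Nil
  then show ?case using lyndon_suffix_le[of x p q] by simp
next
  case (Cons y xs)
  have "y @ concat (xs @ [x]) = p @ q" using Cons.prems by simp
  then consider s where "p = y @ s" "concat (xs @ [x]) = s @ q"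
    | s where "y = p @ s" "s \<noteq> []" "q = s @ concat (xs @ [x])"
    unfolding append_eq_append_conv2 by (metis append_Nil append_Nil2)
  then show ?case
  proof cases
    case 1
    then show ?thesis using Cons.IH[of s] Cons.prems by simp
  next
    case 2
    have "x \<le> y" using Cons.prems by simp
    also have "y \<le> s" using lyndon_suffix_le[of y p s] Cons.prems 2 by simp
    also have "s \<le> q" using 2 by simp
    finally show ?thesis .
  qed
qed

lemma concat_eq_Nil_lyndon: "(\<And>w. w \<in> set ws \<Longrightarrow> lyndon w) \<Longrightarrow> concat ws = [] \<longleftrightarrow> ws = []"
  by (cases ws) (auto simp: lyndon_def)

text \<open>
  The last factor of a nonincreasing factorization is the smallest nonempty suffix of the word, so
  it is determined by the word.
\<close>

lemma lyndon_factorization_unique: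
  assumes "sorted_wrt (\<ge>) xs" "sorted_wrt (\<ge>) ys"
    and "\<And>w. w \<in> set xs \<Longrightarrow> lyndon w" "\<And>w. w \<in> set ys \<Longrightarrow> lyndon w"
    and "concat xs = concat ys"
  shows "xs = ys"
  using assms
proof (induction xs arbitrary: ys rule: rev_induct)
  case Nil
  then show ?case using concat_eq_Nil_lyndon[of ys] by simp
next
  case (snoc x xs)
  have "ys \<noteq> []" using concat_eq_Nil_lyndon[of "xs @ [x]"] snoc.prems by auto
  then obtain ys' y where ys: "ys = ys' @ [y]" by (metis rev_exhaust)
  have xy: "lyndon x" "lyndon y" using snoc.prems(3)[of x] snoc.prems(4)[of y] ys by auto
  have eq: "concat xs @ x = concat ys' @ y" using snoc.prems(5) ys by simp
  have "x \<le> y"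
    using last_lyndon_factor_le_suffix[of xs x "concat ys'" y] snoc.prems eq xy
    by (simp add: lyndon_def)
  moreover have "y \<le> x"
    using last_lyndon_factor_le_suffix[of ys' y "concat xs" x] snoc.prems eq xy ys
    by (simp add: lyndon_def)
  ultimately have "x = y" by simp
  then show ?case using snoc.IH[of ys'] snoc.prems ys eq by (simp add: sorted_wrt_append)
qed

section \<open>Linear independence of the symmetrized products\<close>

text \<open>
  The coefficient of the monomial \<open>M\<close> in the exponential.  The sum runs over the distinct orderings of
  \<open>M\<close>, so that a repeated factor is not counted several times.
\<close>

definition sym_bracket_prod :: "nat list multiset \<Rightarrow> 'a::field_char_0 ncseries" where
  "sym_bracket_prod M = (\<lambda>u. inverse (fact (size M)) * (\<Sum>ws | mset ws = M. bracket_prod ws) u)"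

lemma finite_mset_eq: "finite {ws. mset ws = M}"
  by (rule finite_subset[OF _ finite_lists_length_eq[of "set_mset M" "size M"]]) auto

lemma weighted_monomials_lyndon_lists:
  assumes "mset ws \<in> weighted_monomials d n m"
  shows "ws \<in> lyndon_lists d n"
proof -
  have "(\<Sum>w\<in>#mset ws. length w) = length (concat ws)"
    by (simp only: mset_map[symmetric] sum_mset_sum_list length_concat)
  then show ?thesis
    using assms by (auto simp: weighted_monomials_def lyndon_words_def lyndon_lists_def lyndon_over_def)
qed

lemma lyndon_lists_weighted_monomials:
  assumes "ws \<in> lyndon_lists d n"
  shows "mset ws \<in> weighted_monomials d n n"
proof -
  have "(\<Sum>w\<in>#mset ws. length w) = length (concat ws)"
    by (simp only: mset_map[symmetric] sum_mset_sum_list length_concat)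
  moreover have "length w \<le> length (concat ws)" if "w \<in> set ws" for w
    using that by (auto simp: length_concat intro: member_le_sum_list)
  ultimately show ?thesis
    using assms by (auto simp: weighted_monomials_def lyndon_words_def lyndon_lists_def lyndon_over_def)
qed

lemma size_le_weight:
  assumes "M \<in> weighted_monomials d k m"
  shows "size M \<le> k"
proof -
  have "1 \<le> length w" if "w \<in># M" for w
    using assms that by (cases w) (auto simp: weighted_monomials_def lyndon_words_def lyndon_def)
  then have "(\<Sum>w\<in>#M. 1) \<le> (\<Sum>w\<in>#M. length w)" by (intro sum_mset_mono) auto
  then show ?thesis using assms by (simp add: weighted_monomials_def)
qed

lemma finite_lyndon_words: "finite (lyndon_words d m)"
  by (rule finite_subset[OF _ finite_lists_length_le[of "{1..d}" m]])
    (auto simp: lyndon_words_def)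

lemma finite_weighted_monomials: "finite (weighted_monomials d k m)"
proof (rule finite_subset)
  show "weighted_monomials d k m \<subseteq> mset ` {ws. set ws \<subseteq> lyndon_words d m \<and> length ws \<le> k}"
  proof
    fix M assume M: "M \<in> weighted_monomials d k m"
    obtain ws where ws: "mset ws = M" using ex_mset by blast
    then have "set ws \<subseteq> lyndon_words d m" "length ws \<le> k"
      using M size_le_weight[OF M] by (auto simp: weighted_monomials_def)
    then show "M \<in> mset ` {ws. set ws \<subseteq> lyndon_words d m \<and> length ws \<le> k}" using ws by blast
  qed
qed (intro finite_imageI finite_lists_length_le finite_lyndon_words)

text \<open>
  Up to products of fewer factors, which are in the span by induction, all orderings of \<open>ws\<close> give the
  same product; so \<open>V\<^sub>M\<close> for \<open>M = mset ws\<close> is a positive rational multiple of it.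
\<close>

lemma bracket_prod_in_span_sym_bracket_prod:
  assumes "ws \<in> lyndon_lists d n"
  shows "(bracket_prod ws :: 'a::field_char_0 ncseries) \<in>
    fun_space.span (sym_bracket_prod ` weighted_monomials d n n)"
    (is "_ \<in> fun_space.span ?V")
  using assms
proof (induction "length ws" arbitrary: ws rule: less_induct)
  case less
  let ?bp = "bracket_prod :: nat list list \<Rightarrow> 'a ncseries"
  let ?L = "{xs. mset xs = mset ws}"
  have "shorter_prods d n (length ws) \<subseteq> fun_space.span ?V"
    using less.hyps by (auto simp: shorter_prods_def)
  then have shorter: "fun_space.span (shorter_prods d n (length ws)) \<subseteq> fun_space.span ?V"
    using fun_space.span_mono fun_space.span_span by blast
  have diff: "(\<Sum>xs\<in>?L. ?bp ws - ?bp xs) \<in> fun_space.span ?V"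
    using bracket_prod_perm[OF less.prems, where 'a = 'a] shorter by (intro fun_space.span_sum) auto
  have "(\<lambda>u. fact (length ws) * sym_bracket_prod (mset ws) u) \<in> fun_space.span ?V"
    by (intro fun_space.span_scale fun_space.span_base imageI lyndon_lists_weighted_monomials less.prems)
  also have "(\<lambda>u. fact (length ws) * sym_bracket_prod (mset ws) u) = (\<Sum>xs\<in>?L. ?bp xs)"
    by (simp add: sym_bracket_prod_def fun_eq_iff)
  finally have "(\<Sum>xs\<in>?L. ?bp ws - ?bp xs) + (\<Sum>xs\<in>?L. ?bp xs) \<in> fun_space.span ?V"
    by (rule fun_space.span_add[OF diff])
  also have "(\<Sum>xs\<in>?L. ?bp ws - ?bp xs) + (\<Sum>xs\<in>?L. ?bp xs) = (\<lambda>u. of_nat (card ?L) * ?bp ws u)"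
    by (simp add: sum_subtractf fun_eq_iff sum_fun_apply)
  finally have "(\<lambda>u. inverse (of_nat (card ?L)) * (of_nat (card ?L) * ?bp ws u)) \<in> fun_space.span ?V"
    by (rule fun_space.span_scale)
  \<comment> \<open>characteristic zero: the number of orderings is invertible\<close>
  moreover have "card ?L \<noteq> 0"
    using finite_mset_eq[of "mset ws"] by (auto simp: card_eq_0_iff)
  ultimately show ?case by (simp add: mult.assoc[symmetric])
qed

text \<open>
  For a multiset of Lyndon words, the nonincreasing order makes its elements the Lyndon factorization
  of this word.
\<close>

definition leading_word :: "nat list multiset \<Rightarrow> nat list" where
  "leading_word M = concat (rev (sorted_list_of_multiset M))"

lemma inj_on_leading_word: "inj_on leading_word (weighted_monomials d k m)"
proof (rule inj_onI)
  fix M N assume M: "M \<in> weighted_monomials d k m" and N: "N \<in> weighted_monomials d k m"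
    and eq: "leading_word M = leading_word N"
  have "rev (sorted_list_of_multiset M) = rev (sorted_list_of_multiset N)"
    using M N eq
    by (intro lyndon_factorization_unique)
      (auto simp: sorted_wrt_rev leading_word_def weighted_monomials_def lyndon_words_def
         sorted_sorted_list_of_multiset)
  then show "M = N" by (metis mset_sorted_list_of_multiset rev_rev_ident)
qed

lemma leading_word_in_words:
  assumes "M \<in> weighted_monomials d k m"
  shows "leading_word M \<in> words d k"
proof -
  have "rev (sorted_list_of_multiset M) \<in> lyndon_lists d k"
    using assms by (intro weighted_monomials_lyndon_lists) simp
  then show ?thesis
    by (auto simp: words_def leading_word_def lyndon_lists_def lyndon_over_def)
qed

text \<open>
  Every Lyndon word in a monomial of weight \<open>k\<close> has length at most \<open>k\<close>.
\<close>

lemma weighted_monomials_mono: "weighted_monomials d k m \<subseteq> weighted_monomials d k k"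
proof
  fix M assume M: "M \<in> weighted_monomials d k m"
  obtain ws where ws: "mset ws = M" using ex_mset by blast
  then show "M \<in> weighted_monomials d k k"
    using M weighted_monomials_lyndon_lists lyndon_lists_weighted_monomials by metis
qed

lemma sym_bracket_prod_independent:
  shows "inj_on (sym_bracket_prod :: _ \<Rightarrow> 'a::field_char_0 ncseries) (weighted_monomials d k m)"
    and "fun_space.independent
      ((sym_bracket_prod :: _ \<Rightarrow> 'a ncseries) ` weighted_monomials d k m)"
proof -
  \<comment> \<open>Straightening leaves the words of length at most \<open>m\<close>, so all words of length at most \<open>k\<close> are admitted.\<close>
  let ?J = "weighted_monomials d k k"
  let ?f = "\<lambda>M. bracket_prod (rev (sorted_list_of_multiset M)) :: 'a ncseries"
  have lead: "leads_with (leading_word M) (?f M)" if "M \<in> ?J" for M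
    unfolding leading_word_def
    using that by (intro leads_with_bracket_prod) (auto simp: weighted_monomials_def lyndon_words_def)
  have diag: "?f M (leading_word M) \<noteq> 0" if "M \<in> ?J" for M
    using leads_with_self[OF lead[OF that]] by simp
  have below: "leading_word N \<le> leading_word M"
    if "M \<in> ?J" "N \<in> ?J" "?f N (leading_word M) \<noteq> 0" for M N
    using leads_withD[OF lead[OF that(2)] that(3)] by simp
  note f = independent_if_triangular[of ?J ?f leading_word, OF diag below inj_on_leading_word]
  have "?f ` ?J \<subseteq> fun_space.span (sym_bracket_prod ` ?J)"
  proof
    fix T assume "T \<in> ?f ` ?J"
    then obtain M where M: "M \<in> ?J" "T = ?f M" by blast
    then have "rev (sorted_list_of_multiset M) \<in> lyndon_lists d k"
      by (intro weighted_monomials_lyndon_lists) simp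
    then show "T \<in> fun_space.span (sym_bracket_prod ` ?J)"
      unfolding M(2) by (rule bracket_prod_in_span_sym_bracket_prod)
  qed
  note g = independent_if_spans_independent[OF finite_weighted_monomials f this]
  show "inj_on (sym_bracket_prod :: _ \<Rightarrow> 'a ncseries) (weighted_monomials d k m)"
    using g(1) weighted_monomials_mono by (rule inj_on_subset)
  show "fun_space.independent ((sym_bracket_prod :: _ \<Rightarrow> 'a ncseries) ` weighted_monomials d k m)"
    using g(2) image_mono[OF weighted_monomials_mono] by (rule fun_space.independent_mono)
qed

section \<open>Linear maps between coordinate spaces\<close>

interpretation fun_space_pair: vector_space_pair
  "\<lambda>(c::'a::field) (f::'b \<Rightarrow> 'a) u. c * f u" "\<lambda>(c::'a::field) (f::'c \<Rightarrow> 'a) u. c * f u"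
  ..

definition unit_vec :: "'i \<Rightarrow> 'i \<Rightarrow> complex" where
  "unit_vec j = (\<lambda>i. if i = j then 1 else 0)"

text \<open>
  Additivity and homogeneity are only asked on \<open>coord_space J\<close>, since nothing is known about a
  linear automorphism of the coordinate space on other functions.
\<close>

definition linear_between ::
    "'j set \<Rightarrow> 'i set \<Rightarrow> (('j \<Rightarrow> complex) \<Rightarrow> ('i \<Rightarrow> complex)) \<Rightarrow> bool" where
  "linear_between J I A \<longleftrightarrow>
     (\<forall>v\<in>coord_space J. A v \<in> coord_space I) \<and>
     (\<forall>v\<in>coord_space J. \<forall>w\<in>coord_space J. A (\<lambda>j. v j + w j) = (\<lambda>i. A v i + A w i)) \<and>
     (\<forall>c. \<forall>v\<in>coord_space J. A (\<lambda>j. c * v j) = (\<lambda>i. c * A v i))"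

lemma linear_betweenD:
  assumes "linear_between J I A"
  shows "v \<in> coord_space J \<Longrightarrow> A v \<in> coord_space I"
    and "v \<in> coord_space J \<Longrightarrow> w \<in> coord_space J \<Longrightarrow> A (\<lambda>j. v j + w j) = (\<lambda>i. A v i + A w i)"
    and "v \<in> coord_space J \<Longrightarrow> A (\<lambda>j. c * v j) = (\<lambda>i. c * A v i)"
  using assms unfolding linear_between_def by blast+

lemma linear_between_zero: "linear_between J I A \<Longrightarrow> A (\<lambda>_. 0) = (\<lambda>_. 0)"
  using linear_betweenD(3)[of J I A "\<lambda>_. 0" 0] by (simp add: coord_space_def)

lemma linear_automorphism_linear_between: "linear_automorphism I L \<Longrightarrow> linear_between I I L"
  unfolding linear_automorphism_def linear_between_def bij_betw_def by blast

lemma linear_between_comp: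
  assumes A: "linear_between J I A" and B: "linear_between I K B"
  shows "linear_between J K (\<lambda>v. B (A v))"
  unfolding linear_between_def
  using linear_betweenD[OF A] linear_betweenD[OF B] by simp

lemma sum_unit_vec:
  assumes "finite J" "v \<in> coord_space J"
  shows "v = (\<Sum>j\<in>J. (\<lambda>i. v j * unit_vec j i))"
proof
  fix i
  have "(\<Sum>j\<in>J. v j * unit_vec j i) = (\<Sum>j\<in>J. if j = i then v j else 0)"
    by (intro sum.cong) (auto simp: unit_vec_def)
  then show "v i = (\<Sum>j\<in>J. (\<lambda>i. v j * unit_vec j i)) i"
    using assms by (simp add: sum_fun_apply coord_space_def)
qed

lemma linear_between_expand:
  assumes A: "linear_between J I A" and "finite J" and v: "v \<in> coord_space J"
  shows "A v i = (\<Sum>j\<in>J. v j * A (unit_vec j) i)"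
proof -
  have unit: "unit_vec j \<in> coord_space J" if "j \<in> J" for j
    using that by (auto simp: unit_vec_def coord_space_def)
  have "K \<subseteq> J \<Longrightarrow> (\<Sum>j\<in>K. (\<lambda>i. v j * unit_vec j i)) \<in> coord_space J \<and>
      A (\<Sum>j\<in>K. (\<lambda>i. v j * unit_vec j i)) i = (\<Sum>j\<in>K. v j * A (unit_vec j) i)" if "finite K" for K
    using that
  proof induction
    case empty
    then show ?case
      using linear_between_zero[OF A] by (simp add: coord_space_def zero_fun_def)
  next
    case (insert j K)
    let ?s = "\<Sum>j\<in>K. (\<lambda>i. v j * unit_vec j i)" and ?t = "\<lambda>i. v j * unit_vec j i"
    have IH: "?s \<in> coord_space J" "A ?s i = (\<Sum>j\<in>K. v j * A (unit_vec j) i)"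
      using insert by auto
    have t: "?t \<in> coord_space J" using unit[of j] insert.prems by (simp add: coord_space_def)
    have sum: "(\<Sum>j\<in>insert j K. (\<lambda>i. v j * unit_vec j i)) = (\<lambda>i. ?t i + ?s i)"
      using insert.hyps by (simp add: plus_fun_def)
    have "A (\<lambda>i. ?t i + ?s i) i = v j * A (unit_vec j) i + A ?s i"
      using linear_betweenD(2)[OF A t IH(1)] linear_betweenD(3)[OF A unit[of j], of "v j"] insert.prems
      by simp
    moreover have "(\<lambda>i. ?t i + ?s i) \<in> coord_space J"
      using t IH(1) by (simp add: coord_space_def)
    ultimately show ?case
      unfolding sum using IH(2) insert.hyps by simp
  qed
  from this[OF \<open>finite J\<close>] show ?thesis using sum_unit_vec[OF \<open>finite J\<close> v] by simp
qed

lemma subspace_coord_space: "fun_space.subspace (coord_space I)"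
  by (simp add: fun_space.subspace_def coord_space_def)

text \<open>
  Extend both families to bases of the coordinate space and match the added vectors arbitrarily; both
  bases have the same size.
\<close>

lemma automorphism_between_independent_families:
  fixes a e :: "'j \<Rightarrow> 'i \<Rightarrow> complex"
  assumes fin: "finite I" "finite J"
    and a: "a ` J \<subseteq> coord_space I" "inj_on a J" "fun_space.independent (a ` J)"
    and e: "e ` J \<subseteq> coord_space I" "inj_on e J" "fun_space.independent (e ` J)"
  shows "\<exists>L. linear_automorphism I L \<and> (\<forall>j\<in>J. L (a j) = e j)"
proof -
  let ?V = "coord_space I"
  have span_V: "?V \<subseteq> fun_space.span (unit_vec ` I)"
  proof
    fix v assume "v \<in> ?V"
    then have "v = (\<Sum>j\<in>I. (\<lambda>i. v j * unit_vec j i))" using fin(1) by (rule sum_unit_vec[rotated])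
    also have "\<dots> \<in> fun_space.span (unit_vec ` I)"
      by (intro fun_space.span_sum fun_space.span_scale fun_space.span_base imageI)
    finally show "v \<in> fun_space.span (unit_vec ` I)" .
  qed
  obtain B where B: "a ` J \<subseteq> B" "B \<subseteq> ?V" "fun_space.independent B" "?V \<subseteq> fun_space.span B"
    using fun_space.maximal_independent_subset_extend[OF a(1) a(3)] .
  obtain C where C: "e ` J \<subseteq> C" "C \<subseteq> ?V" "fun_space.independent C" "?V \<subseteq> fun_space.span C"
    using fun_space.maximal_independent_subset_extend[OF e(1) e(3)] .
  have finB: "finite B"
    using fun_space.independent_span_bound[of "unit_vec ` I" B] B span_V fin by blast
  have finC: "finite C"
    using fun_space.independent_span_bound[of "unit_vec ` I" C] C span_V fin by blast
  have card: "card B = card C"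
    using fun_space.independent_span_bound[of B C] fun_space.independent_span_bound[of C B]
      B C finB finC by (meson order_antisym order_trans)
  have spanB: "fun_space.span B = ?V"
    using fun_space.span_minimal[OF B(2) subspace_coord_space] B(4) by blast
  have spanC: "fun_space.span C = ?V"
    using fun_space.span_minimal[OF C(2) subspace_coord_space] C(4) by blast
  have "card (B - a ` J) = card (C - e ` J)"
    using B(1) C(1) finB finC card card_image[OF a(2)] card_image[OF e(2)] fin
    by (simp add: card_Diff_subset)
  then obtain r where r: "bij_betw r (B - a ` J) (C - e ` J)"
    using finite_same_card_bij[of "B - a ` J" "C - e ` J"] finB finC by blast
  \<comment> \<open>the bijection of the bases that extends \<open>a j \<mapsto> e j\<close>\<close>
  define f where "f b = (if b \<in> a ` J then e (inv_into J a b) else r b)" for b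
  have "bij_betw (e \<circ> inv_into J a) (a ` J) (e ` J)"
    using bij_betw_inv_into[OF inj_on_imp_bij_betw[OF a(2)]] inj_on_imp_bij_betw[OF e(2)]
    by (rule bij_betw_trans)
  then have "bij_betw f (a ` J) (e ` J)"
    by (rule iffD1[OF bij_betw_cong, rotated]) (simp add: f_def)
  moreover have "bij_betw f (B - a ` J) (C - e ` J)"
    using r by (rule iffD1[OF bij_betw_cong, rotated]) (simp add: f_def)
  ultimately have "bij_betw f (a ` J \<union> (B - a ` J)) (e ` J \<union> (C - e ` J))"
    by (rule bij_betw_combine) auto
  then have f: "bij_betw f B C" using B(1) C(1) by (simp add: Un_absorb1)
  define L where "L = fun_space_pair.construct B f"
  define L' where "L' = fun_space_pair.construct C (inv_into B f)"
  have linL: "Vector_Spaces.linear (\<lambda>(c::complex) (f::'i \<Rightarrow> complex) u. c * f u) (\<lambda>c f u. c * f u) L"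
    unfolding L_def by (rule fun_space_pair.linear_construct[OF B(3)])
  have linL': "Vector_Spaces.linear (\<lambda>(c::complex) (f::'i \<Rightarrow> complex) u. c * f u) (\<lambda>c f u. c * f u) L'"
    unfolding L'_def by (rule fun_space_pair.linear_construct[OF C(3)])
  have L_B: "L b = f b" if "b \<in> B" for b
    unfolding L_def by (rule fun_space_pair.construct_basis[OF B(3) that])
  have L'_C: "L' c = inv_into B f c" if "c \<in> C" for c
    unfolding L'_def by (rule fun_space_pair.construct_basis[OF C(3) that])
  have imL: "L v \<in> ?V" if "v \<in> ?V" for v
    using that fun_space_pair.construct_in_span[OF B(3), of f v] f
    unfolding L_def by (simp add: bij_betw_def spanC)
  have imL': "L' v \<in> ?V" if "v \<in> ?V" for v
    using that fun_space_pair.construct_in_span[OF C(3), of "inv_into B f" v]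
      bij_betw_inv_into[OF f] unfolding L'_def by (simp add: bij_betw_def spanB)
  have id: "Vector_Spaces.linear (\<lambda>(c::complex) (f::'i \<Rightarrow> complex) u. c * f u) (\<lambda>c f u. c * f u) (\<lambda>x. x)"
    by (rule fun_space.linear_ident)
  have L'L: "L' (L v) = v" if "v \<in> ?V" for v
    using fun_space_pair.linear_eq_on[OF Vector_Spaces.linear_compose[OF linL linL'] id, of v B]
      that f L_B L'_C by (auto simp: spanB bij_betw_def)
  have LL': "L (L' v) = v" if "v \<in> ?V" for v
    using fun_space_pair.linear_eq_on[OF Vector_Spaces.linear_compose[OF linL' linL] id, of v C]
      that bij_betw_inv_into[OF f] L_B L'_C f
    by (auto simp: spanC bij_betw_def f_inv_into_f inv_into_into)
  have "bij_betw L ?V ?V"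
    by (rule bij_betw_byWitness[where f' = L']) (use L'L LL' imL imL' in auto)
  moreover have "L (\<lambda>i. u i + v i) = (\<lambda>i. L u i + L v i)" for u v
    using module_hom.add[OF linL[unfolded linear_iff_module_hom], of u v] by (simp add: plus_fun_def)
  moreover have "L (\<lambda>i. c * v i) = (\<lambda>i. c * L v i)" for c v
    using module_hom.scale[OF linL[unfolded linear_iff_module_hom], of c v] .
  ultimately have "linear_automorphism I L" unfolding linear_automorphism_def by blast
  moreover have "L (a j) = e j" if "j \<in> J" for j
    using L_B[of "a j"] B(1) that inv_into_f_f[OF a(2) that] by (auto simp: f_def)
  ultimately show ?thesis by blast
qed

definition family_comb :: "'j set \<Rightarrow> ('j \<Rightarrow> 'i \<Rightarrow> complex) \<Rightarrow> ('j \<Rightarrow> complex) \<Rightarrow> 'i \<Rightarrow> complex" where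
  "family_comb J a z = (\<lambda>i. \<Sum>j\<in>J. z j * a j i)"

lemma linear_between_family_comb:
  assumes "a ` J \<subseteq> coord_space I"
  shows "linear_between J I (family_comb J a)"
  unfolding linear_between_def
proof (intro conjI ballI allI)
  show "family_comb J a v \<in> coord_space I" for v
  proof -
    have "a j i = 0" if "j \<in> J" "i \<notin> I" for i j
      using assms that unfolding coord_space_def by blast
    then show ?thesis by (simp add: coord_space_def family_comb_def)
  qed
qed (simp_all add: family_comb_def algebra_simps sum.distrib sum_distrib_left fun_eq_iff)

lemma family_comb_unit_vec:
  assumes "finite J" "j \<in> J"
  shows "family_comb J a (unit_vec j) = a j"
proof
  fix i
  have "family_comb J a (unit_vec j) i = (\<Sum>l\<in>J. if l = j then a l i else 0)"
    unfolding family_comb_def unit_vec_def by (intro sum.cong) auto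
  then show "family_comb J a (unit_vec j) i = a j i" using assms by simp
qed

lemma linear_between_apply_family_comb:
  assumes fin: "finite J" and a: "a ` J \<subseteq> coord_space I" and L: "linear_between I K L"
    and La: "\<And>j. j \<in> J \<Longrightarrow> L (a j) = e j" and z: "z \<in> coord_space J"
  shows "L (family_comb J a z) = family_comb J e z"
proof
  fix i
  have "L (family_comb J a z) i = (\<Sum>j\<in>J. z j * L (family_comb J a (unit_vec j)) i)"
    by (rule linear_between_expand[OF linear_between_comp[OF linear_between_family_comb[OF a] L] fin z])
  also have "\<dots> = family_comb J e z i"
    unfolding family_comb_def[of J e]
    by (intro sum.cong refl) (simp add: family_comb_unit_vec[OF fin] La)
  finally show "L (family_comb J a z) i = family_comb J e z i" .
qed

section \<open>Polynomials\<close>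

lemma eval_monom_simps [simp]:
  "eval_monom x {#} = 1" "eval_monom x (add_mset i M) = x i * eval_monom x M"
  "eval_monom x (M + N) = eval_monom x M * eval_monom x N"
  by (simp_all add: eval_monom_def)

lemma eval_monom_scale: "eval_monom (\<lambda>i. c * x i) M = c ^ size M * eval_monom x M"
  by (induction M) auto

text \<open>
  Polynomials are built from an explicit finite set \<open>K\<close> of monomials; coefficients may be zero, so the
  keys are only contained in \<open>K\<close>.
\<close>

definition poly_of :: "'i multiset set \<Rightarrow> ('i multiset \<Rightarrow> complex) \<Rightarrow> 'i cpoly" where
  "poly_of K f = (\<Sum>M\<in>K. Poly_Mapping.single M (f M))"

lemma keys_poly_of: "Poly_Mapping.keys (poly_of K f) \<subseteq> K"
  unfolding poly_of_def
  using keys_sum[of "\<lambda>M. Poly_Mapping.single M (f M)" K] by (auto split: if_splits)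

lemma lookup_poly_of: "finite K \<Longrightarrow> M \<in> K \<Longrightarrow> Poly_Mapping.lookup (poly_of K f) M = f M"
  by (simp add: poly_of_def lookup_sum lookup_single when_def)

lemma eval_poly_superset:
  assumes "finite K" "Poly_Mapping.keys h \<subseteq> K"
  shows "eval_poly x h = (\<Sum>M\<in>K. Poly_Mapping.lookup h M * eval_monom x M)"
  unfolding eval_poly_def
  by (rule sum.mono_neutral_left) (use assms in \<open>auto simp: in_keys_iff\<close>)

lemma eval_poly_of: "finite K \<Longrightarrow> eval_poly x (poly_of K f) = (\<Sum>M\<in>K. f M * eval_monom x M)"
  by (subst eval_poly_superset[OF _ keys_poly_of]) (simp_all add: lookup_poly_of)

text \<open>
  The closure properties below hold for functions without a choice of representing polynomials.
\<close>

definition polynomial_function :: "'i set \<Rightarrow> (('i \<Rightarrow> complex) \<Rightarrow> complex) \<Rightarrow> bool" where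
  "polynomial_function I F \<longleftrightarrow> (\<exists>h. poly_in I h \<and> F = (\<lambda>x. eval_poly x h))"

lemma polynomial_function_monom:
  assumes "set_mset M \<subseteq> I"
  shows "polynomial_function I (\<lambda>x. c * eval_monom x M)"
proof -
  have "poly_in I (poly_of {M} (\<lambda>_. c))"
    using assms keys_poly_of[of "{M}"] by (auto simp: poly_in_def)
  moreover have "eval_poly x (poly_of {M} (\<lambda>_. c)) = c * eval_monom x M" for x
    by (simp add: eval_poly_of)
  ultimately show ?thesis unfolding polynomial_function_def by metis
qed

lemma polynomial_function_add:
  assumes "polynomial_function I F" "polynomial_function I G"
  shows "polynomial_function I (\<lambda>x. F x + G x)"
proof -
  obtain f g where f: "poly_in I f" "F = (\<lambda>x. eval_poly x f)"
    and g: "poly_in I g" "G = (\<lambda>x. eval_poly x g)"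
    using assms by (auto simp: polynomial_function_def)
  let ?K = "Poly_Mapping.keys f \<union> Poly_Mapping.keys g"
  have "poly_in I (f + g)" using f g keys_add[of f g] unfolding poly_in_def by blast
  moreover have "eval_poly x (f + g) = eval_poly x f + eval_poly x g" for x
    using keys_add[of f g]
    by (simp add: eval_poly_superset[of ?K] lookup_add algebra_simps sum.distrib)
  ultimately show ?thesis unfolding polynomial_function_def f(2) g(2) by metis
qed

lemma polynomial_function_const: "polynomial_function I (\<lambda>x. c)"
  using polynomial_function_monom[of "{#}" I c] by simp

lemma polynomial_function_sum:
  "(\<And>s. s \<in> S \<Longrightarrow> polynomial_function I (F s)) \<Longrightarrow> polynomial_function I (\<lambda>x. \<Sum>s\<in>S. F s x)"
  by (induction S rule: infinite_finite_induct)
    (auto intro: polynomial_function_add polynomial_function_const)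

lemma polynomial_function_mult:
  assumes "polynomial_function I F" "polynomial_function I G"
  shows "polynomial_function I (\<lambda>x. F x * G x)"
proof -
  obtain f g where f: "poly_in I f" "F = (\<lambda>x. eval_poly x f)"
    and g: "poly_in I g" "G = (\<lambda>x. eval_poly x g)"
    using assms by (auto simp: polynomial_function_def)
  have "polynomial_function I (\<lambda>x. \<Sum>M\<in>Poly_Mapping.keys f. \<Sum>N\<in>Poly_Mapping.keys g.
      (Poly_Mapping.lookup f M * Poly_Mapping.lookup g N) * eval_monom x (M + N))"
    by (intro polynomial_function_sum polynomial_function_monom)
      (use f(1) g(1) in \<open>auto simp: poly_in_def\<close>)
  then show ?thesis
    unfolding f(2) g(2) eval_poly_def sum_product by (simp add: algebra_simps)
qed

lemma polynomial_function_eval_monom: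
  "(\<And>i. i \<in># M \<Longrightarrow> polynomial_function J (\<lambda>x. T x i)) \<Longrightarrow>
    polynomial_function J (\<lambda>x. eval_monom (T x) M)"
  by (induction M) (auto intro: polynomial_function_const polynomial_function_mult)

lemma polynomial_function_subst:
  assumes h: "poly_in I h" and T: "\<And>i. i \<in> I \<Longrightarrow> polynomial_function J (\<lambda>x. T x i)"
  shows "polynomial_function J (\<lambda>x. eval_poly (T x) h)"
  unfolding eval_poly_def
  by (intro polynomial_function_sum polynomial_function_mult polynomial_function_const
      polynomial_function_eval_monom T) (use h in \<open>auto simp: poly_in_def\<close>)

definition linear_form :: "'j set \<Rightarrow> ('j \<Rightarrow> complex) \<Rightarrow> 'j cpoly" where
  "linear_form J c = poly_of ((\<lambda>j. {#j#}) ` J) (\<lambda>M. c (the_elem (set_mset M)))"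

lemma linear_form:
  assumes "finite J"
  shows "poly_in J (linear_form J c)" "homogeneous 1 (linear_form J c)"
    "eval_poly x (linear_form J c) = (\<Sum>j\<in>J. x j * c j)"
proof -
  let ?K = "(\<lambda>j. {#j#}) ` J"
  show "poly_in J (linear_form J c)" "homogeneous 1 (linear_form J c)"
    using keys_poly_of[of ?K] unfolding linear_form_def poly_in_def homogeneous_def by fastforce+
  show "eval_poly x (linear_form J c) = (\<Sum>j\<in>J. x j * c j)"
    using assms unfolding linear_form_def
    by (subst eval_poly_of) (auto simp: sum.reindex inj_on_def mult.commute intro: sum.cong)
qed

definition matrix_form ::
    "'j set \<Rightarrow> (('j \<Rightarrow> complex) \<Rightarrow> 'i \<Rightarrow> complex) \<Rightarrow> 'i \<Rightarrow> 'j cpoly" where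
  "matrix_form J A i = linear_form J (\<lambda>j. A (unit_vec j) i)"

lemma eval_matrix_form:
  "finite J \<Longrightarrow> linear_between J I A \<Longrightarrow> v \<in> coord_space J \<Longrightarrow> eval_poly v (matrix_form J A i) = A v i"
  unfolding matrix_form_def by (simp add: linear_form linear_between_expand)

lemma eval_poly_linear_subst:
  assumes "finite J" "linear_between J I A" "poly_in I h"
  obtains h' where "poly_in J h'" "\<And>v. v \<in> coord_space J \<Longrightarrow> eval_poly v h' = eval_poly (A v) h"
proof -
  have "polynomial_function J (\<lambda>x. eval_poly (\<lambda>i. eval_poly x (matrix_form J A i)) h)"
  proof (rule polynomial_function_subst[OF assms(3)])
    show "polynomial_function J (\<lambda>x. eval_poly x (matrix_form J A i))" for i
      using linear_form[OF assms(1)] unfolding polynomial_function_def matrix_form_def by blast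
  qed
  then obtain h' where h': "poly_in J h'"
    "(\<lambda>x. eval_poly (\<lambda>i. eval_poly x (matrix_form J A i)) h) = (\<lambda>x. eval_poly x h')"
    unfolding polynomial_function_def by blast
  show ?thesis
  proof
    fix v assume "v \<in> coord_space J"
    then have "(\<lambda>i. eval_poly v (matrix_form J A i)) = A v"
      using eval_matrix_form[OF assms(1,2)] by (intro ext)
    then show "eval_poly v h' = eval_poly (A v) h" using fun_cong[OF h'(2), of v] by simp
  qed (rule h')
qed

section \<open>Zariski closures under linear embeddings\<close>

lemma zariski_closureD:
  "v \<in> zariski_closure I S \<Longrightarrow> poly_in I h \<Longrightarrow> (\<And>s. s \<in> S \<Longrightarrow> eval_poly s h = 0) \<Longrightarrow> eval_poly v h = 0"
  unfolding zariski_closure_def by blast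

lemma zariski_closure_subset: "zariski_closure I S \<subseteq> coord_space I"
  unfolding zariski_closure_def by blast

text \<open>
  Linear substitution pulls polynomials back along \<open>A\<close> and along \<open>B\<close>, which compares the closures.
  That the closure of \<open>A ` S\<close> stays in the image of \<open>A\<close> is seen from the linear forms
  \<open>v \<mapsto> A (B v) i - v i\<close>: they vanish on \<open>A ` S\<close>, hence on its closure.
\<close>

lemma zariski_closure_linear_image:
  assumes fin: "finite I" "finite J"
    and A: "linear_between J I A" and B: "linear_between I J B"
    and BA: "\<And>v. v \<in> coord_space J \<Longrightarrow> B (A v) = v" and S: "S \<subseteq> coord_space J"
  shows "zariski_closure I (A ` S) = A ` zariski_closure J S"
proof (intro equalityI subsetI)
  fix y assume y: "y \<in> zariski_closure I (A ` S)"
  then have yI: "y \<in> coord_space I" using zariski_closure_subset by blast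
  note AB = linear_between_comp[OF B A]
  have "A (B y) i = y i" for i
  proof -
    let ?h = "\<lambda>v. eval_poly v (matrix_form I (\<lambda>v. A (B v)) i) + (-1) * eval_poly v (matrix_form I (\<lambda>v. v) i)"
    have id: "linear_between I I (\<lambda>v. v)" by (simp add: linear_between_def)
    have "polynomial_function I ?h"
      by (intro polynomial_function_add polynomial_function_mult polynomial_function_const)
        (use linear_form[OF fin(1)] in \<open>unfold polynomial_function_def matrix_form_def, blast+\<close>)
    then obtain h where h: "poly_in I h" "?h = (\<lambda>x. eval_poly x h)"
      unfolding polynomial_function_def by blast
    have eval: "eval_poly v h = A (B v) i - v i" if "v \<in> coord_space I" for v
      using fun_cong[OF h(2), of v] eval_matrix_form[OF fin(1) AB that]
        eval_matrix_form[OF fin(1) id that] by simp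
    have "eval_poly y h = 0"
    proof (rule zariski_closureD[OF y h(1)])
      fix s assume "s \<in> A ` S"
      then obtain t where t: "t \<in> coord_space J" "s = A t" using S by blast
      then show "eval_poly s h = 0"
        using eval[of s] BA[OF t(1)] linear_betweenD(1)[OF A t(1)] by simp
    qed
    then show ?thesis using eval[OF yI] by simp
  qed
  then have y_eq: "y = A (B y)" by auto
  have "B y \<in> zariski_closure J S"
    unfolding zariski_closure_def
  proof (intro CollectI conjI allI impI)
    show "B y \<in> coord_space J" using linear_betweenD(1)[OF B yI] .
    fix h assume h: "poly_in J h \<and> (\<forall>s\<in>S. eval_poly s h = 0)"
    obtain h' where h': "poly_in I h'" "\<And>v. v \<in> coord_space I \<Longrightarrow> eval_poly v h' = eval_poly (B v) h"
      using eval_poly_linear_subst[OF fin(1) B] h by blast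
    have "eval_poly y h' = 0"
    proof (rule zariski_closureD[OF y h'(1)])
      fix s assume "s \<in> A ` S"
      then obtain t where t: "t \<in> S" "s = A t" by blast
      then show "eval_poly s h' = 0"
        using h'(2)[of s] BA[of t] linear_betweenD(1)[OF A, of t] S h by auto
    qed
    then show "eval_poly (B y) h = 0" using h'(2)[OF yI] by simp
  qed
  then show "y \<in> A ` zariski_closure J S" using y_eq by blast
next
  fix y assume "y \<in> A ` zariski_closure J S"
  then obtain z where z: "z \<in> zariski_closure J S" "y = A z" by blast
  then have zJ: "z \<in> coord_space J" using zariski_closure_subset by blast
  show "y \<in> zariski_closure I (A ` S)"
    unfolding zariski_closure_def
  proof (intro CollectI conjI allI impI)
    show "y \<in> coord_space I" using linear_betweenD(1)[OF A zJ] z by simp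
    fix h assume h: "poly_in I h \<and> (\<forall>s\<in>A ` S. eval_poly s h = 0)"
    obtain h' where h': "poly_in J h'" "\<And>v. v \<in> coord_space J \<Longrightarrow> eval_poly v h' = eval_poly (A v) h"
      using eval_poly_linear_subst[OF fin(2) A] h by blast
    have "eval_poly z h' = 0"
      by (rule zariski_closureD[OF z(1) h'(1)]) (use h h'(2) S in auto)
    then show "eval_poly y h = 0" using h'(2)[OF zJ] z(2) by simp
  qed
qed

section \<open>Projective varieties\<close>

lemma proj_point_self: "v \<in> proj_point v"
  unfolding proj_point_def by (auto intro: exI[of _ 1])

lemma proj_point_scale: "c \<noteq> 0 \<Longrightarrow> proj_point (\<lambda>i. c * v i) = proj_point v"
proof (intro equalityI subsetI)
  fix w assume "c \<noteq> 0" "w \<in> proj_point v"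
  then obtain a where a: "a \<noteq> 0" "w = (\<lambda>i. a * v i)" by (auto simp: proj_point_def)
  then have "w = (\<lambda>i. (a / c) * (c * v i))" "a / c \<noteq> 0" using \<open>c \<noteq> 0\<close> by auto
  then show "w \<in> proj_point (\<lambda>i. c * v i)" unfolding proj_point_def by blast
next
  fix w assume "c \<noteq> 0" "w \<in> proj_point (\<lambda>i. c * v i)"
  then obtain a where a: "a \<noteq> 0" "w = (\<lambda>i. a * (c * v i))" unfolding proj_point_def by blast
  then have "w = (\<lambda>i. (a * c) * v i)" "a * c \<noteq> 0" using \<open>c \<noteq> 0\<close> by auto
  then show "w \<in> proj_point v" unfolding proj_point_def by blast
qed

lemma image_proj_point:
  assumes A: "linear_between J I A" and v: "v \<in> coord_space J"
  shows "A ` proj_point v = proj_point (A v)"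
proof -
  have "A ` proj_point v = {A (\<lambda>j. c * v j) | c. c \<noteq> 0}" unfolding proj_point_def by auto
  also have "\<dots> = proj_point (A v)" unfolding proj_point_def linear_betweenD(3)[OF A v] ..
  finally show ?thesis .
qed

lemma image_projectivization:
  assumes A: "linear_between J I A" and Z: "Z \<subseteq> coord_space J"
    and nz: "\<And>v. v \<in> Z \<Longrightarrow> A v = (\<lambda>_. 0) \<Longrightarrow> v = (\<lambda>_. 0)"
  shows "(\<lambda>p. A ` p) ` projectivization Z = projectivization (A ` Z)"
proof -
  have "A ` Z - {\<lambda>_. 0} = A ` (Z - {\<lambda>_. 0})"
    using nz linear_between_zero[OF A] by auto
  moreover have "(\<lambda>p. A ` p) ` projectivization Z = (\<lambda>v. proj_point (A v)) ` (Z - {\<lambda>_. 0})"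
    unfolding projectivization_def image_image
    by (intro image_cong refl image_proj_point[OF A]) (use Z in blast)
  ultimately show ?thesis by (simp add: projectivization_def image_image)
qed

lemma projectivization_subset: "Z \<subseteq> coord_space I \<Longrightarrow> projectivization Z \<subseteq> proj_space I"
  unfolding proj_space_def projectivization_def by blast

lemma proj_open_proj_space: "proj_open I (proj_space I)"
proof -
  let ?one = "poly_of {{#}} (\<lambda>_. 1) :: 'a cpoly"
  have "poly_in I ?one" "homogeneous 0 ?one"
    using keys_poly_of[of "{{#}}" "\<lambda>_. 1"] by (auto simp: poly_in_def homogeneous_def)
  moreover have "eval_poly v ?one = 1" for v by (simp add: eval_poly_of)
  moreover have "p \<noteq> {}" if "p \<in> proj_space I" for p
    using that proj_point_self by (auto simp: proj_space_def projectivization_def)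
  ultimately have "proj_closure I {} = {}"
    unfolding proj_closure_def by fastforce
  then show ?thesis by (simp add: proj_open_def)
qed

text \<open>
  Linear forms describe the morphism on all of projective space, so a single chart is enough.
\<close>

lemma proj_morphism_linear:
  assumes fin: "finite I" and T: "linear_between I J T" and X: "X \<subseteq> coord_space I"
    and nz: "\<And>v. v \<in> X \<Longrightarrow> T v = (\<lambda>_. 0) \<Longrightarrow> v = (\<lambda>_. 0)"
  shows "proj_morphism I (projectivization X) J (projectivization (T ` X)) (\<lambda>p. T ` p)"
  unfolding proj_morphism_def
proof (intro conjI ballI)
  show "(\<lambda>p. T ` p) ` projectivization X \<subseteq> projectivization (T ` X)"
    using image_projectivization[OF T X nz] by simp
  fix p assume p: "p \<in> projectivization X"
  show "\<exists>U n F. proj_open I U \<and> p \<in> U \<and>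
        (\<forall>j\<in>J. poly_in I (F j) \<and> homogeneous n (F j)) \<and>
        (\<forall>q\<in>projectivization X \<inter> U. \<forall>v\<in>q. (\<exists>j\<in>J. eval_poly v (F j) \<noteq> 0) \<and>
           T ` q = proj_point (\<lambda>j. if j \<in> J then eval_poly v (F j) else 0))"
  proof (intro exI conjI ballI)
    show "proj_open I (proj_space I)" by (rule proj_open_proj_space)
    show "p \<in> proj_space I" using p projectivization_subset[OF X] by blast
    show "poly_in I (matrix_form I T j)" "homogeneous 1 (matrix_form I T j)" for j
      unfolding matrix_form_def by (rule linear_form[OF fin])+
    fix q v assume q: "q \<in> projectivization X \<inter> proj_space I" and v: "v \<in> q"
    then obtain x where x: "x \<in> X" "x \<noteq> (\<lambda>_. 0)" "q = proj_point x"
      by (auto simp: projectivization_def)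
    then obtain c where c: "c \<noteq> 0" "v = (\<lambda>i. c * x i)" using v by (auto simp: proj_point_def)
    have xI: "x \<in> coord_space I" using x X by blast
    then have vI: "v \<in> coord_space I" using c by (simp add: coord_space_def)
    have Tv: "T v = (\<lambda>j. c * T x j)" using linear_betweenD(3)[OF T xI] c by simp
    have eval: "eval_poly v (matrix_form I T j) = T v j" for j
      by (rule eval_matrix_form[OF fin T vI])
    have TvJ: "T v j = 0" if "j \<notin> J" for j
      using linear_betweenD(1)[OF T vI] that by (simp add: coord_space_def)
    have "T x \<noteq> (\<lambda>_. 0)" using nz x by blast
    then obtain j where "T v j \<noteq> 0" using Tv c by fastforce
    then show "\<exists>j\<in>J. eval_poly v (matrix_form I T j) \<noteq> 0" using eval TvJ by metis
    have "(\<lambda>j. if j \<in> J then eval_poly v (matrix_form I T j) else 0) = T v"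
      using eval TvJ by auto
    moreover have "T ` q = proj_point (T v)"
      using image_proj_point[OF T xI] by (simp add: x(3) Tv proj_point_scale[OF c(1)])
    ultimately show "T ` q = proj_point (\<lambda>j. if j \<in> J then eval_poly v (matrix_form I T j) else 0)"
      by simp
  qed
qed

lemma proj_isomorphic_linear:
  assumes fin: "finite I" "finite J"
    and A: "linear_between J I A" and B: "linear_between I J B"
    and BA: "\<And>v. v \<in> coord_space J \<Longrightarrow> B (A v) = v" and Z: "Z \<subseteq> coord_space J"
  shows "proj_isomorphic I (projectivization (A ` Z)) J (projectivization Z)"
proof -
  have BAZ: "B ` A ` Z = Z" using BA Z by force
  have AZ: "A ` Z \<subseteq> coord_space I" using linear_betweenD(1)[OF A] Z by blast
  have nzA: "v = (\<lambda>_. 0)" if "v \<in> Z" "A v = (\<lambda>_. 0)" for v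
    using BA[of v] that Z linear_between_zero[OF B] by auto
  have m1: "proj_morphism I (projectivization (A ` Z)) J (projectivization (B ` A ` Z)) (\<lambda>p. B ` p)"
  proof (rule proj_morphism_linear[OF fin(1) B AZ])
    fix v assume "v \<in> A ` Z" "B v = (\<lambda>_. 0)"
    then show "v = (\<lambda>_. 0)" using BA Z linear_between_zero[OF A] by auto
  qed
  have m2: "proj_morphism J (projectivization Z) I (projectivization (A ` Z)) (\<lambda>p. A ` p)"
    by (rule proj_morphism_linear[OF fin(2) A Z nzA])
  have BAp: "B ` A ` p = p" if p: "p \<in> projectivization Z" for p
  proof -
    obtain v where v: "v \<in> coord_space J" "p = proj_point v"
      using p Z unfolding projectivization_def by blast
    then show ?thesis
      using image_proj_point[OF A v(1)] image_proj_point[OF B linear_betweenD(1)[OF A v(1)]] BA by simp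
  qed
  have ABq: "A ` B ` q = q" if q: "q \<in> projectivization (A ` Z)" for q
  proof -
    have "(\<lambda>p. A ` p) ` projectivization Z = projectivization (A ` Z)"
      by (rule image_projectivization[OF A Z nzA])
    then obtain p where p: "p \<in> projectivization Z" "q = A ` p" using q by blast
    show ?thesis unfolding p(2) BAp[OF p(1)] ..
  qed
  show ?thesis
    unfolding proj_isomorphic_def
    using m1[unfolded BAZ] m2 ABq BAp
    by (intro exI[of _ "\<lambda>p. B ` p"] exI[of _ "\<lambda>p. A ` p"] conjI ballI)
qed

text \<open>
  Along the line through \<open>s\<close> the polynomial becomes a polynomial in the scalar \<open>c\<close>, whose coefficients
  are the homogeneous parts at \<open>s\<close>.
\<close>

lemma homogeneous_part_vanishes:
  assumes cone: "\<And>c. eval_poly (\<lambda>i. c * s i) h = 0"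
  shows "(\<Sum>M | M \<in> Poly_Mapping.keys h \<and> size M = n. Poly_Mapping.lookup h M * eval_monom s M) = 0"
proof -
  let ?K = "Poly_Mapping.keys h" and ?a = "\<lambda>M. Poly_Mapping.lookup h M * eval_monom s M"
  define N where "N = Max (insert n (size ` ?K))"
  have N: "size M \<le> N" if "M \<in> ?K" for M unfolding N_def using that by simp
  have nN: "n \<le> N" unfolding N_def by simp
  have "(\<Sum>j\<le>N. (\<Sum>M | M \<in> ?K \<and> size M = j. ?a M) * c ^ j) = 0" for c
  proof -
    have "(\<Sum>j\<le>N. (\<Sum>M | M \<in> ?K \<and> size M = j. ?a M) * c ^ j) =
        (\<Sum>j\<le>N. \<Sum>M | M \<in> ?K \<and> size M = j. c ^ size M * ?a M)"
      by (intro sum.cong refl) (simp add: sum_distrib_left mult.commute)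
    also have "\<dots> = (\<Sum>M\<in>?K. c ^ size M * ?a M)"
      by (rule sum.group) (use N in auto)
    also have "\<dots> = eval_poly (\<lambda>i. c * s i) h"
      unfolding eval_poly_def by (intro sum.cong refl) (simp add: eval_monom_scale)
    finally show ?thesis using cone by simp
  qed
  then show ?thesis using polyfun_eq_0[of "\<lambda>j. \<Sum>M | M \<in> ?K \<and> size M = j. ?a M" N] nN by blast
qed

text \<open>
  The projective closure only tests homogeneous polynomials.  On a cone, a polynomial vanishes iff
  all its homogeneous parts do, so they suffice for the affine closure as well.
\<close>

lemma proj_closure_cone:
  assumes S: "S \<subseteq> coord_space I" and cone: "\<And>c s. s \<in> S \<Longrightarrow> (\<lambda>i. c * s i) \<in> S"
    and s0: "s0 \<in> S" "s0 \<noteq> (\<lambda>_. 0)"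
  shows "proj_closure I (projectivization S) = projectivization (zariski_closure I S)"
proof (intro equalityI subsetI)
  fix p assume p: "p \<in> proj_closure I (projectivization S)"
  then obtain v where v: "v \<in> coord_space I" "v \<noteq> (\<lambda>_. 0)" "p = proj_point v"
    unfolding proj_closure_def proj_space_def projectivization_def by blast
  have "v \<in> zariski_closure I S"
    unfolding zariski_closure_def
  proof (intro CollectI conjI allI impI)
    show "v \<in> coord_space I" by (rule v)
    fix h assume h: "poly_in I h \<and> (\<forall>s\<in>S. eval_poly s h = 0)"
    let ?K = "Poly_Mapping.keys h"
    let ?part = "\<lambda>n. poly_of {M \<in> ?K. size M = n} (Poly_Mapping.lookup h)"
    have eval: "eval_poly x (?part n) =
        (\<Sum>M | M \<in> ?K \<and> size M = n. Poly_Mapping.lookup h M * eval_monom x M)" for x n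
      by (rule eval_poly_of) simp
    have "eval_poly v (?part n) = 0" for n
    proof -
      have "poly_in I (?part n)" "homogeneous n (?part n)"
        using keys_poly_of[of "{M \<in> ?K. size M = n}" "Poly_Mapping.lookup h"] h
        unfolding poly_in_def homogeneous_def by blast+
      moreover have "eval_poly w (?part n) = 0" if q: "q \<in> projectivization S" "w \<in> q" for q w
      proof -
        obtain c s where s: "s \<in> S" "w = (\<lambda>i. c * s i)"
          using q by (auto simp: projectivization_def proj_point_def)
        then have "w \<in> S" using cone by blast
        then have "eval_poly (\<lambda>i. c * w i) h = 0" for c using cone h by blast
        then show ?thesis unfolding eval by (rule homogeneous_part_vanishes)
      qed
      ultimately show ?thesis
        using p proj_point_self[of v] v(3) unfolding proj_closure_def by blast
    qed
    then have "(\<Sum>n\<in>size ` ?K. \<Sum>M | M \<in> ?K \<and> size M = n.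
        Poly_Mapping.lookup h M * eval_monom v M) = 0"
      unfolding eval by simp
    then show "eval_poly v h = 0"
      unfolding eval_poly_def by (subst (asm) sum.group) auto
  qed
  then show "p \<in> projectivization (zariski_closure I S)"
    using v unfolding projectivization_def by blast
next
  fix p assume "p \<in> projectivization (zariski_closure I S)"
  then obtain v where v: "v \<in> zariski_closure I S" "v \<noteq> (\<lambda>_. 0)" "p = proj_point v"
    unfolding projectivization_def by blast
  show "p \<in> proj_closure I (projectivization S)"
    unfolding proj_closure_def
  proof (intro CollectI conjI allI impI ballI)
    show "p \<in> proj_space I"
      using v zariski_closure_subset unfolding proj_space_def projectivization_def by blast
    fix n h w
    assume h: "poly_in I h \<and> homogeneous n h \<and> (\<forall>q\<in>projectivization S. \<forall>v\<in>q. eval_poly v h = 0)"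
      and w: "w \<in> p"
    have scale: "eval_poly (\<lambda>i. c * x i) h = c ^ n * eval_poly x h" for c x
      unfolding eval_poly_def sum_distrib_left
      using h by (intro sum.cong) (simp_all add: eval_monom_scale homogeneous_def)
    have nonzero: "eval_poly s h = 0" if "s \<in> S" "s \<noteq> (\<lambda>_. 0)" for s
    proof -
      have "proj_point s \<in> projectivization S" using that unfolding projectivization_def by blast
      then show ?thesis using h proj_point_self by blast
    qed
    have "eval_poly s h = 0" if "s \<in> S" for s
    proof (cases "s = (\<lambda>_. 0)")
      \<comment> \<open>a homogeneous polynomial takes the value \<open>0\<^sup>n h(s0)\<close> at the origin, also for \<open>n = 0\<close>\<close>
      case True
      then show ?thesis using scale[of 0 s0] nonzero[OF s0] by simp
    qed (rule nonzero[OF that])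
    then have "eval_poly v h = 0" using zariski_closureD[OF v(1)] h by blast
    then show "eval_poly w h = 0" using w v(3) scale by (auto simp: proj_point_def)
  qed
qed

section \<open>The exponential\<close>

lemma lyndon_comb_eq_sum:
  "lyndon_comb d m x = (\<Sum>w\<in>lyndon_words d m. (\<lambda>u. x w * lyndon_bracket w u))"
  by (simp add: lyndon_comb_def fun_eq_iff sum_fun_apply)

lemma tensor_power_lyndon_comb:
  "tensor_power (lyndon_comb d m x) n =
    (\<Sum>ws | set ws \<subseteq> lyndon_words d m \<and> length ws = n.
       (\<lambda>u. eval_monom x (mset ws) * bracket_prod ws u))"
proof (induction n)
  case 0
  have "{ws. set ws \<subseteq> lyndon_words d m \<and> length ws = 0} = {[]}" by auto
  then show ?case by (simp add: fun_eq_iff)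
next
  case (Suc n)
  let ?W = "lyndon_words d m"
  let ?Ws = "\<lambda>n. {ws. set ws \<subseteq> ?W \<and> length ws = n}"
  let ?t = "\<lambda>ws u. eval_monom x (mset ws) * bracket_prod ws u"
  have "tensor_power (lyndon_comb d m x) (Suc n) =
      (\<Sum>w\<in>?W. \<Sum>ws\<in>?Ws n. tensor_mult (\<lambda>u. x w * lyndon_bracket w u) (?t ws))"
    by (simp only: tensor_power.simps Suc.IH)
      (simp only: lyndon_comb_eq_sum tensor_mult_sum_left tensor_mult_sum_right, rule sum.swap)
  also have "\<dots> = (\<Sum>w\<in>?W. \<Sum>ws\<in>?Ws n. ?t (w # ws))"
    by (intro sum.cong refl) (simp add: tensor_mult_simps fun_eq_iff)
  also have "\<dots> = (\<Sum>(w, ws)\<in>?W \<times> ?Ws n. ?t (w # ws))"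
    by (rule sum.cartesian_product)
  also have "\<dots> = (\<Sum>ws\<in>?Ws (Suc n). ?t ws)"
    by (rule sum.reindex_bij_witness[where i = "\<lambda>ws. (hd ws, tl ws)" and j = "\<lambda>(w, ws). w # ws"])
      (auto simp: length_Suc_conv)
  finally show ?case .
qed

lemma bracket_prod_nonzero_length:
  assumes "ws \<in> lyndon_lists d n" "bracket_prod ws u \<noteq> 0"
  shows "length u = n"
proof -
  have "leads_with (concat ws) (bracket_prod ws)"
    using assms(1) by (intro leads_with_bracket_prod) (auto simp: lyndon_lists_def lyndon_over_def)
  then show ?thesis using leads_withD assms by (fastforce simp: lyndon_lists_def)
qed

lemma tensor_mult_letters:
  assumes S: "\<And>u. S u \<noteq> 0 \<Longrightarrow> set u \<subseteq> A" and T: "\<And>u. T u \<noteq> 0 \<Longrightarrow> set u \<subseteq> A"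
    and "tensor_mult S T u \<noteq> 0"
  shows "set u \<subseteq> A"
proof -
  obtain i where "S (take i u) * T (drop i u) \<noteq> 0"
    using assms(3) unfolding tensor_mult_def by (meson sum.neutral)
  then have "S (take i u) \<noteq> 0" "T (drop i u) \<noteq> 0" by auto
  then have "set (take i u) \<subseteq> A" "set (drop i u) \<subseteq> A" using S T by blast+
  then show ?thesis using set_append[of "take i u" "drop i u"] by simp
qed

lemma lyndon_bracket_letters:
  "(lyndon_bracket w :: 'a::comm_ring_1 ncseries) u \<noteq> 0 \<Longrightarrow> set u \<subseteq> set w"
proof (induction w arbitrary: u rule: lyndon_bracket.induct)
  case (1 w)
  let ?P = "lyndon_bracket :: nat list \<Rightarrow> 'a ncseries"
  let ?p = "min_suffix_rest w" and ?q = "min_suffix w"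
  show ?case
  proof (cases "length w \<le> 1")
    case True
    then show ?thesis
      using "1.prems" by (auto simp: lyndon_bracket_short word_series_def split: if_splits)
  next
    case False
    then have "set w = set ?p \<union> set ?q" by (intro length_set_min_suffix) simp
    then have p: "?P ?p u \<noteq> 0 \<Longrightarrow> set u \<subseteq> set w" and q: "?P ?q u \<noteq> 0 \<Longrightarrow> set u \<subseteq> set w" for u
      using "1.IH"(1)[OF False, of u] "1.IH"(2)[OF False, of u] by blast+
    have "tensor_mult (?P ?p) (?P ?q) u \<noteq> 0 \<or> tensor_mult (?P ?q) (?P ?p) u \<noteq> 0"
      using "1.prems" by (auto simp: lyndon_bracket_long[OF False] lie_bracket_def)
    then show ?thesis using tensor_mult_letters[OF p q] tensor_mult_letters[OF q p] by blast
  qed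
qed

lemma bracket_prod_letters:
  "set ws \<subseteq> lyndon_over d \<Longrightarrow> (bracket_prod ws :: 'a::comm_ring_1 ncseries) u \<noteq> 0 \<Longrightarrow> set u \<subseteq> {1..d}"
proof (induction ws arbitrary: u)
  case Nil
  then show ?case by (auto simp: word_series_def split: if_splits)
next
  case (Cons w ws)
  have w: "(lyndon_bracket w :: 'a ncseries) u \<noteq> 0 \<Longrightarrow> set u \<subseteq> {1..d}" for u
    using Cons.prems(1) lyndon_bracket_letters[of w u] by (fastforce simp: lyndon_over_def)
  have ws: "(bracket_prod ws :: 'a ncseries) u \<noteq> 0 \<Longrightarrow> set u \<subseteq> {1..d}" for u
    using Cons.IH Cons.prems(1) by simp
  show ?case using tensor_mult_letters[OF w ws] Cons.prems(2) by simp
qed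

lemma sym_bracket_prod_coord_space:
  assumes M: "M \<in> weighted_monomials d k m"
  shows "sym_bracket_prod M \<in> coord_space (words d k)"
  unfolding coord_space_def
proof (intro CollectI allI impI)
  fix u assume u: "u \<notin> words d k"
  have "bracket_prod ws u = (0::complex)" if ws: "mset ws = M" for ws
  proof (rule ccontr)
    assume nz: "bracket_prod ws u \<noteq> (0::complex)"
    have "ws \<in> lyndon_lists d k" using weighted_monomials_lyndon_lists M ws by blast
    then show False
      using bracket_prod_nonzero_length[OF _ nz] bracket_prod_letters[OF _ nz] u
      by (auto simp: words_def lyndon_lists_def)
  qed
  then show "sym_bracket_prod M u = (0::complex)"
    by (simp add: sym_bracket_prod_def sum_fun_apply)
qed

text \<open>
  The \<open>n\<close>-th power contributes the lists of \<open>n\<close> Lyndon words; at a word of length \<open>k\<close> only those of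
  total length \<open>k\<close> count.  Grouping the lists first by length and then by multiset gives the
  coefficient of each monomial.
\<close>

lemma rough_veronese_map_lyndon_comb:
  "rough_veronese_map k (lyndon_comb d m x) =
    family_comb (weighted_monomials d k m) sym_bracket_prod (eval_monom x)"
    (is "_ = family_comb ?J _ _")
proof
  fix u :: "nat list"
  show "rough_veronese_map k (lyndon_comb d m x) u = family_comb ?J sym_bracket_prod (eval_monom x) u"
  proof (cases "length u = k")
    case False
    have "sym_bracket_prod M u = (0::complex)" if "M \<in> ?J" for M
      using sym_bracket_prod_coord_space[OF that] False by (simp add: coord_space_def words_def)
    then show ?thesis
      using False by (simp add: rough_veronese_map_def tensor_proj_def family_comb_def)
  next
    case True
    let ?K = "{ws. mset ws \<in> ?J}"
    let ?t = "\<lambda>ws. eval_monom x (mset ws) * bracket_prod ws u"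
    have K: "set ws \<subseteq> lyndon_words d m" "length ws \<le> k" if "ws \<in> ?K" for ws
      using that size_le_weight[of "mset ws"] by (auto simp: weighted_monomials_def)
    have finK: "finite ?K"
      by (rule finite_subset[OF _ finite_lists_length_le[OF finite_lyndon_words, of d m k]])
        (use K in auto)
    have power: "tensor_power (lyndon_comb d m x) n u = (\<Sum>ws | ws \<in> ?K \<and> length ws = n. ?t ws)" for n
    proof -
      let ?Ws = "{ws. set ws \<subseteq> lyndon_words d m \<and> length ws = n}"
      have "tensor_power (lyndon_comb d m x) n u = (\<Sum>ws\<in>?Ws. ?t ws)"
        by (simp add: tensor_power_lyndon_comb sum_fun_apply)
      also have "\<dots> = (\<Sum>ws | ws \<in> ?K \<and> length ws = n. ?t ws)"
      proof (rule sum.mono_neutral_right)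
        show "finite ?Ws" by (rule finite_lists_length_eq[OF finite_lyndon_words])
        show "{ws. ws \<in> ?K \<and> length ws = n} \<subseteq> ?Ws" using K(1) by blast
        show "\<forall>ws\<in>?Ws - {ws. ws \<in> ?K \<and> length ws = n}. ?t ws = 0"
        proof
          fix ws assume ws: "ws \<in> ?Ws - {ws. ws \<in> ?K \<and> length ws = n}"
          have list: "ws \<in> lyndon_lists d (length (concat ws))"
            using ws by (auto simp: lyndon_lists_def lyndon_words_def lyndon_over_def)
          have "length (concat ws) \<noteq> k"
          proof
            assume "length (concat ws) = k"
            then have "mset ws \<in> weighted_monomials d k k"
              using lyndon_lists_weighted_monomials list by simp
            then have "mset ws \<in> ?J" using ws by (simp add: weighted_monomials_def)
            then show False using ws by simp
          qed
          then have "bracket_prod ws u = (0::complex)"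
            using bracket_prod_nonzero_length[OF list, of u] True by metis
          then show "?t ws = 0" by simp
        qed
      qed
      finally show ?thesis .
    qed
    have "tensor_exp (lyndon_comb d m x) u =
        (\<Sum>n\<le>k. tensor_power (lyndon_comb d m x) n u / fact n)"
      unfolding tensor_exp_def
    proof (rule suminf_finite)
      fix n assume "n \<notin> {..k}"
      then have empty: "{ws. ws \<in> ?K \<and> length ws = n} = {}" using K(2) by fastforce
      show "tensor_power (lyndon_comb d m x) n u / fact n = 0" unfolding power empty by simp
    qed simp
    also have "\<dots> = (\<Sum>n\<le>k. \<Sum>ws | ws \<in> ?K \<and> length ws = n. ?t ws / fact (length ws))"
      unfolding power by (intro sum.cong refl) (simp add: sum_divide_distrib)
    also have "\<dots> = (\<Sum>ws\<in>?K. ?t ws / fact (length ws))"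
      by (rule sum.group) (use finK K(2) in auto)
    also have "\<dots> = (\<Sum>M\<in>?J. \<Sum>ws | ws \<in> ?K \<and> mset ws = M. ?t ws / fact (length ws))"
      by (rule sum.group[symmetric]) (use finK finite_weighted_monomials in auto)
    also have "\<dots> = (\<Sum>M\<in>?J. eval_monom x M * sym_bracket_prod M u)"
    proof (rule sum.cong[OF refl])
      fix M assume "M \<in> ?J"
      then have "{ws. ws \<in> ?K \<and> mset ws = M} = {ws. mset ws = M}" by auto
      moreover have "(\<Sum>ws | mset ws = M. ?t ws / fact (length ws)) =
          (\<Sum>ws | mset ws = M. eval_monom x M * (inverse (fact (size M)) * bracket_prod ws u))"
        by (intro sum.cong refl) (auto simp: field_simps)
      ultimately show "(\<Sum>ws | ws \<in> ?K \<and> mset ws = M. ?t ws / fact (length ws)) =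
          eval_monom x M * sym_bracket_prod M u"
        by (simp add: sym_bracket_prod_def sum_fun_apply sum_distrib_left)
    qed
    finally show ?thesis
      using True by (simp add: rough_veronese_map_def tensor_proj_def family_comb_def)
  qed
qed

section \<open>The complexified Lie algebra\<close>

lemma tensor_mult_of_real:
  "tensor_mult (\<lambda>u. complex_of_real (S u)) (\<lambda>u. complex_of_real (T u)) =
    (\<lambda>u. complex_of_real (tensor_mult S T u))"
  by (simp add: tensor_mult_def fun_eq_iff)

lemma lyndon_bracket_of_real: "lyndon_bracket w = (\<lambda>u. complex_of_real (lyndon_bracket w u))"
proof (induction w rule: lyndon_bracket.induct)
  case (1 w)
  show ?case
  proof (cases "length w \<le> 1")
    case True
    then show ?thesis by (simp add: lyndon_bracket_short word_series_def fun_eq_iff)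
  next
    case False
    show ?thesis
      unfolding lyndon_bracket_long[OF False] lie_bracket_def
      by (subst (1 2) "1.IH"(1)[OF False], subst (1 2) "1.IH"(2)[OF False])
        (simp add: tensor_mult_of_real)
  qed
qed

lemma lyndon_bracket_free_lie:
  "w \<noteq> [] \<Longrightarrow> set w \<subseteq> {1..d} \<Longrightarrow> lyndon_bracket w \<in> free_lie d"
proof (induction w rule: lyndon_bracket.induct)
  case (1 w)
  show ?case
  proof (cases "length w \<le> 1")
    case True
    then obtain i where "w = [i]" using "1.prems" by (cases w) auto
    then show ?thesis using free_lie.letter[of i d] "1.prems" by (simp add: lyndon_bracket_short)
  next
    case False
    then have len: "2 \<le> length w" by simp
    show ?thesis
      unfolding lyndon_bracket_long[OF False]
      using "1.IH"(1)[OF False] "1.IH"(2)[OF False] min_suffix(2,3)[OF len]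
        length_set_min_suffix(2)[OF len] "1.prems"
      by (intro free_lie.bracket) auto
  qed
qed

lemma free_lie_sum:
  "(\<And>i. i \<in> I \<Longrightarrow> F i \<in> free_lie d) \<Longrightarrow> (\<lambda>u. \<Sum>i\<in>I. F i u) \<in> free_lie d"
  by (induction I rule: infinite_finite_induct) (auto intro: free_lie.zero free_lie.add)

lemma lyndon_bracket_nonzero_length:
  assumes "lyndon w" "lyndon_bracket w u \<noteq> 0"
  shows "length u = length w"
  using leads_withD[OF leads_with_lyndon_bracket[OF assms(1)] assms(2)] by simp

text \<open>
  A Lie element is a finite combination of \<open>P\<^sub>w\<close>.  As each \<open>P\<^sub>w\<close> is homogeneous of degree \<open>|w|\<close>,
  dropping those with \<open>|w| > m\<close> does not change the coefficients of words of length at most \<open>m\<close>.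
\<close>

lemma lie_upto_eq:
  "lie_upto d m = range (\<lambda>a u. \<Sum>w\<in>lyndon_words d m. a w * lyndon_bracket w u)"
proof (intro equalityI subsetI)
  fix T assume T: "T \<in> lie_upto d m"
  then have "T \<in> fun_space.span (lyndon_bracket ` lyndon_over d)"
    by (intro free_lie_subset_span) (simp add: lie_upto_def)
  then obtain t r where t: "finite t" "t \<subseteq> lyndon_bracket ` lyndon_over d"
    "T = (\<Sum>a\<in>t. (\<lambda>u. r a * a u))"
    unfolding fun_space.span_explicit by blast
  obtain F where F: "F \<subseteq> lyndon_over d" "inj_on (lyndon_bracket :: _ \<Rightarrow> real ncseries) F"
    "t = lyndon_bracket ` F"
    using t(2) unfolding subset_image_inj by blast
  have finF: "finite F" using t(1) F by (metis finite_imageD)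
  let ?a = "\<lambda>w. if w \<in> F then r (lyndon_bracket w) else 0"
  have "T u = (\<Sum>w\<in>lyndon_words d m. ?a w * lyndon_bracket w u)" for u
  proof (cases "length u \<le> m")
    case True
    have "T u = (\<Sum>w\<in>F. r (lyndon_bracket w) * lyndon_bracket w u)"
      unfolding t(3) F(3) sum_fun_apply using F(2) by (simp add: sum.reindex)
    also have "\<dots> = (\<Sum>w\<in>F \<inter> lyndon_words d m. r (lyndon_bracket w) * lyndon_bracket w u)"
    proof (rule sum.mono_neutral_right[OF finF], blast, intro ballI)
      fix w assume w: "w \<in> F - F \<inter> lyndon_words d m"
      then have "lyndon w" "length w > m"
        using F(1) by (auto simp: lyndon_words_def lyndon_over_def)
      then have "lyndon_bracket w u = (0::real)"
        using lyndon_bracket_nonzero_length[of w u] True by fastforce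
      then show "r (lyndon_bracket w) * lyndon_bracket w u = 0" by simp
    qed
    also have "\<dots> = (\<Sum>w\<in>lyndon_words d m. ?a w * lyndon_bracket w u)"
      by (rule sum.mono_neutral_cong_left) (auto simp: finite_lyndon_words)
    finally show ?thesis .
  next
    case False
    have "lyndon_bracket w u = (0::real)" if "w \<in> lyndon_words d m" for w
      using that False lyndon_bracket_nonzero_length[of w u] by (fastforce simp: lyndon_words_def)
    then show ?thesis using T False by (simp add: lie_upto_def)
  qed
  then show "T \<in> range (\<lambda>a u. \<Sum>w\<in>lyndon_words d m. a w * lyndon_bracket w u)"
    by (intro range_eqI[of _ _ ?a] ext)
next
  fix T :: "real ncseries"
  assume "T \<in> range (\<lambda>a u. \<Sum>w\<in>lyndon_words d m. a w * lyndon_bracket w u)"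
  then obtain a where T: "T = (\<lambda>u. \<Sum>w\<in>lyndon_words d m. a w * lyndon_bracket w u)" by blast
  have "T \<in> free_lie d"
    unfolding T
    by (intro free_lie_sum free_lie.scale lyndon_bracket_free_lie) (auto simp: lyndon_words_def lyndon_def)
  moreover have "T u = 0" if "m < length u" for u
  proof -
    have "lyndon_bracket w u = (0::real)" if "w \<in> lyndon_words d m" for w
      using that \<open>m < length u\<close> lyndon_bracket_nonzero_length[of w u]
      by (fastforce simp: lyndon_words_def)
    then show ?thesis by (simp add: T)
  qed
  ultimately show "T \<in> lie_upto d m" by (simp add: lie_upto_def)
qed

text \<open>
  The bracketings have real coefficients, so the real and imaginary parts of a combination are the
  combinations with the real and imaginary parts of the scalars.
\<close>

lemma lie_upto_complex_eq: "lie_upto_complex d m = range (lyndon_comb d m)"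
proof -
  have comb: "lyndon_comb d m (\<lambda>w. Complex (a w) (b w)) =
      (\<lambda>u. Complex (\<Sum>w\<in>lyndon_words d m. a w * lyndon_bracket w u)
        (\<Sum>w\<in>lyndon_words d m. b w * lyndon_bracket w u))" for a b
    unfolding lyndon_comb_def lyndon_bracket_of_real
    by (simp add: fun_eq_iff complex_eq_iff)
  show ?thesis
  proof (intro equalityI subsetI)
    fix T assume "T \<in> lie_upto_complex d m"
    then obtain a b where "T = lyndon_comb d m (\<lambda>w. Complex (a w) (b w))"
      unfolding lie_upto_complex_def lie_upto_eq comb by blast
    then show "T \<in> range (lyndon_comb d m)" by blast
  next
    fix T assume "T \<in> range (lyndon_comb d m)"
    then obtain x where "T = lyndon_comb d m (\<lambda>w. Complex (Re (x w)) (Im (x w)))" by auto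
    note T = this[unfolded comb]
    show "T \<in> lie_upto_complex d m"
      unfolding lie_upto_complex_def lie_upto_eq
      by (intro CollectI exI conjI, rule T) (rule rangeI)+
  qed
qed

section \<open>The Rough Veronese variety\<close>

definition weighted_monomial_vec :: "nat \<Rightarrow> nat \<Rightarrow> nat \<Rightarrow> (nat list \<Rightarrow> complex) \<Rightarrow> nat list multiset \<Rightarrow> complex" where
  "weighted_monomial_vec d k m x =
     (\<lambda>M. if M \<in> weighted_monomials d k m then eval_monom x M else 0)"

lemma complex_root_exists:
  fixes c :: complex
  assumes "0 < k"
  obtains t where "t ^ k = c"
proof
  show "rcis (root k (cmod c)) (Arg c / k) ^ k = c"
    using assms by (simp add: DeMoivre2 rcis_cmod_Arg real_root_pow_pos2)
qed

lemma eval_monom_weighted_scale: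
  "eval_monom (\<lambda>w. t ^ length w * x w) M = t ^ (\<Sum>w\<in>#M. length w) * eval_monom x M"
  by (induction M) (auto simp: power_add)

text \<open>
  The scalar \<open>c\<close> has a \<open>k\<close>-th root \<open>t\<close>, and multiplying \<open>x\<^sub>w\<close> by \<open>t\<^bsup>|w|\<^esup>\<close> multiplies each monomial of
  weight \<open>k\<close> by \<open>t\<^sup>k = c\<close>.
\<close>

lemma weighted_monomial_vec_cone:
  assumes "0 < k" "s \<in> range (weighted_monomial_vec d k m)"
  shows "(\<lambda>M. c * s M) \<in> range (weighted_monomial_vec d k m)"
proof -
  obtain x where s: "s = weighted_monomial_vec d k m x" using assms by blast
  obtain t where t: "t ^ k = c" using complex_root_exists[OF assms(1)] .
  have "(\<lambda>M. c * s M) = weighted_monomial_vec d k m (\<lambda>w. t ^ length w * x w)"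
    unfolding s weighted_monomial_vec_def eval_monom_weighted_scale
    by (rule ext) (auto simp: weighted_monomials_def t)
  then show ?thesis by blast
qed

lemma weighted_monomials_nonempty:
  assumes "1 \<le> d" "1 \<le> m"
  shows "replicate_mset k [1] \<in> weighted_monomials d k m"
proof -
  have "lyndon [1]" by (auto simp: lyndon_def Cons_eq_append_conv)
  then show ?thesis using assms by (auto simp: weighted_monomials_def lyndon_words_def in_replicate_mset)
qed

lemma finite_words: "finite (words d k)"
  by (rule finite_subset[OF _ finite_lists_length_eq[of "{1..d}" k]]) (auto simp: words_def)

lemma sym_bracket_prod_automorphism:
  assumes "e ` weighted_monomials d k m \<subseteq> coord_space (words d k)"
    and "inj_on e (weighted_monomials d k m)"
    and "fun_space.independent (e ` weighted_monomials d k m)"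
  shows "\<exists>L. linear_automorphism (words d k) L \<and>
    (\<forall>M\<in>weighted_monomials d k m. L (sym_bracket_prod M) = e M)"
  using automorphism_between_independent_families[OF finite_words finite_weighted_monomials
      _ sym_bracket_prod_independent assms] sym_bracket_prod_coord_space by blast

theorem proposition19:
  fixes d k m :: nat
  assumes "2 \<le> d" and "1 \<le> m" and "m \<le> k"
  shows
    "(\<exists>L \<iota>. linear_automorphism (words d k) L \<and>
        inj_on \<iota> (weighted_monomials d k m) \<and>
        \<iota> ` weighted_monomials d k m \<subseteq> words d k \<and>
        (\<forall>x. (\<forall>M\<in>weighted_monomials d k m.
                L (rough_veronese_map k (lyndon_comb d m x)) (\<iota> M) = eval_monom x M) \<and>
             (\<forall>u\<in>words d k - \<iota> ` weighted_monomials d k m.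
                L (rough_veronese_map k (lyndon_comb d m x)) u = 0))) \<and>
     proj_isomorphic (words d k) (rough_veronese d k m)
       (weighted_monomials d k m)
       (proj_closure (weighted_monomials d k m)
          (monomial_image (weighted_monomials d k m) (\<lambda>M. M))) \<and>
     toric (words d k) (rough_veronese d k m)"
proof -
  define I where "I = words d k"
  define J where "J = weighted_monomials d k m"
  let ?\<iota> = leading_word
  let ?V = "sym_bracket_prod :: nat list multiset \<Rightarrow> complex ncseries"
  let ?mon = "weighted_monomial_vec d k m"
  have fin: "finite I" "finite J"
    unfolding I_def J_def by (rule finite_words, rule finite_weighted_monomials)
  have \<iota>: "inj_on ?\<iota> J" "?\<iota> ` J \<subseteq> I"
    unfolding I_def J_def using inj_on_leading_word leading_word_in_words by blast+
  have V: "?V ` J \<subseteq> coord_space I"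
    unfolding I_def J_def using sym_bracket_prod_coord_space by blast
  have k: "0 < k" using assms by simp
  define S where "S = range ?mon"
  have S: "S \<subseteq> coord_space J"
    by (auto simp: S_def weighted_monomial_vec_def coord_space_def J_def)
  have image: "monomial_image J (\<lambda>M. M) = projectivization S"
    unfolding monomial_image_def S_def weighted_monomial_vec_def J_def ..
  define M0 where "M0 = replicate_mset k [1::nat]"
  have M0: "M0 \<in> J"
    unfolding M0_def J_def using weighted_monomials_nonempty assms by simp
  have "?mon (\<lambda>_. 1) M0 = 1"
    using M0 by (simp add: weighted_monomial_vec_def J_def M0_def eval_monom_def)
  then obtain s0 where s0: "s0 \<in> S" "s0 M0 = 1"
    unfolding S_def by blast
  have cone: "(\<lambda>M. c * s M) \<in> S" if "s \<in> S" for c s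
    using weighted_monomial_vec_cone[OF k] that unfolding S_def by blast
  define A where "A = family_comb J ?V"
  define Z where "Z = zariski_closure J S"
  have Z: "Z \<subseteq> coord_space J" unfolding Z_def by (rule zariski_closure_subset)
  have A: "linear_between J I A"
    unfolding A_def using V by (rule linear_between_family_comb)
  have map: "rough_veronese_map k (lyndon_comb d m x) = A (?mon x)" for x
    unfolding rough_veronese_map_lyndon_comb A_def family_comb_def J_def weighted_monomial_vec_def
    by simp
  have map_image: "rough_veronese_map k ` lie_upto_complex d m = A ` S"
    unfolding lie_upto_complex_eq S_def image_image map ..

  \<comment> \<open>Reading off the coordinates \<open>\<iota> M\<close> is a left inverse of every embedding used below.\<close>
  define restrict where "restrict v = (\<lambda>M. if M \<in> J then v (?\<iota> M) else 0)"
    for v :: "nat list \<Rightarrow> complex"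
  have restrict: "linear_between I J restrict"
    by (auto simp: linear_between_def restrict_def coord_space_def)
  have family_indep: "inj_on e J" "fun_space.independent (e ` J)"
    if "\<And>M N. M \<in> J \<Longrightarrow> N \<in> J \<Longrightarrow> e N (?\<iota> M) = (if M = N then 1 else 0)"
    for e :: "nat list multiset \<Rightarrow> nat list \<Rightarrow> complex"
    by (rule independent_if_triangular[of J e ?\<iota>, OF _ _ \<iota>(1)];
        use that in \<open>auto split: if_splits\<close>)+
  have restrict_comb: "restrict (family_comb J e z) = z"
    if e: "\<And>M N. M \<in> J \<Longrightarrow> N \<in> J \<Longrightarrow> e N (?\<iota> M) = (if M = N then 1 else 0)"
      and z: "z \<in> coord_space J" for e z
  proof
    fix M
    show "restrict (family_comb J e z) M = z M"
    proof (cases "M \<in> J")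
      case True
      have "(\<Sum>N\<in>J. z N * e N (?\<iota> M)) = (\<Sum>N\<in>J. if N = M then z N else 0)"
        by (intro sum.cong) (use e[OF True] in auto)
      then show ?thesis using True fin by (simp add: restrict_def family_comb_def)
    next
      case False
      then show ?thesis using z by (simp add: restrict_def coord_space_def)
    qed
  qed

  define e where "e M = (unit_vec (?\<iota> M) :: nat list \<Rightarrow> complex)" for M
  have e_\<iota>: "e N (?\<iota> M) = (if M = N then 1 else 0)" if "M \<in> J" "N \<in> J" for M N
    using \<iota>(1) that by (auto simp: e_def unit_vec_def inj_on_eq_iff)
  have e: "e ` J \<subseteq> coord_space I"
    using \<iota>(2) by (auto simp: e_def unit_vec_def coord_space_def)
  obtain L where L: "linear_automorphism I L" "\<And>M. M \<in> J \<Longrightarrow> L (?V M) = e M"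
    using sym_bracket_prod_automorphism[of e d k m] e family_indep[OF e_\<iota>]
    unfolding I_def J_def by blast
  have linL: "linear_between I I L" using L(1) by (rule linear_automorphism_linear_between)
  have LA: "L (A z) = family_comb J e z" if "z \<in> coord_space J" for z
    unfolding A_def using linear_between_apply_family_comb[OF fin(2) V linL L(2) that] .
  define B where "B v = restrict (L v)" for v
  have B: "linear_between I J B"
    unfolding B_def using linL restrict by (rule linear_between_comp)
  have BA: "B (A z) = z" if "z \<in> coord_space J" for z
    unfolding B_def LA[OF that] using e_\<iota> that by (rule restrict_comb)
  have rough: "rough_veronese d k m = projectivization (A ` Z)"
    unfolding rough_veronese_def map_image Z_def I_def[symmetric]
    by (simp only: zariski_closure_linear_image[OF fin A B BA S])

  have monomial: "linear_automorphism I L \<and> inj_on ?\<iota> J \<and> ?\<iota> ` J \<subseteq> I \<and>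
      (\<forall>x. (\<forall>M\<in>J. L (rough_veronese_map k (lyndon_comb d m x)) (?\<iota> M) = eval_monom x M) \<and>
           (\<forall>u\<in>I - ?\<iota> ` J. L (rough_veronese_map k (lyndon_comb d m x)) u = 0))"
  proof (intro conjI allI ballI)
    fix x
    have mon: "?mon x \<in> coord_space J" using S unfolding S_def by blast
    show "L (rough_veronese_map k (lyndon_comb d m x)) (?\<iota> M) = eval_monom x M" if "M \<in> J" for M
      using fun_cong[OF BA[OF mon], of M] that
      by (simp add: map B_def restrict_def weighted_monomial_vec_def J_def)
    show "L (rough_veronese_map k (lyndon_comb d m x)) u = 0" if "u \<in> I - ?\<iota> ` J" for u
      unfolding map LA[OF mon] family_comb_def
      using that by (intro sum.neutral) (auto simp: e_def unit_vec_def)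
  qed (rule L \<iota>)+

  have iso: "proj_isomorphic I (rough_veronese d k m) J (proj_closure J (monomial_image J (\<lambda>M. M)))"
  proof -
    have "s0 \<noteq> (\<lambda>_. 0)" using s0(2) by auto
    from proj_closure_cone[OF S cone s0(1) this] show ?thesis
      unfolding image rough Z_def[symmetric] using proj_isomorphic_linear[OF fin A B BA Z] by simp
  qed

  have toric: "toric I (rough_veronese d k m)"
  proof -
    \<comment> \<open>\<open>g u\<close> is the monomial in coordinate \<open>u\<close>; \<open>M0\<close> fills the coordinates that carry none\<close>
    define g where "g u = (if u \<in> ?\<iota> ` J then inv_into J ?\<iota> u else M0)" for u
    have g: "g u \<in> J" for u using M0 by (auto simp: g_def inv_into_into)
    have g_\<iota>: "g (?\<iota> M) = M" if "M \<in> J" for M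
      using that \<iota>(1) by (simp add: g_def)
    define e' where "e' M u = (if u \<in> I \<and> g u = M then 1 else 0 :: complex)" for M u
    have e'_\<iota>: "e' N (?\<iota> M) = (if M = N then 1 else 0)" if "M \<in> J" "N \<in> J" for M N
      using \<iota>(2) g_\<iota> that by (auto simp: e'_def)
    have e': "e' ` J \<subseteq> coord_space I" by (auto simp: e'_def coord_space_def)
    \<comment> \<open>the embedding that repeats coordinates of \<open>z\<close> according to \<open>g\<close>\<close>
    define E where "E = family_comb J e'"
    have E: "linear_between J I E" unfolding E_def using e' by (rule linear_between_family_comb)
    have rE: "restrict (E z) = z" if "z \<in> coord_space J" for z
      unfolding E_def using e'_\<iota> that by (rule restrict_comb)
    have E_apply: "E z u = (if u \<in> I then z (g u) else 0)" for z u
    proof -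
      have "(\<Sum>M\<in>J. z M * e' M u) = (\<Sum>M\<in>J. if M = g u then (if u \<in> I then z M else 0) else 0)"
        by (intro sum.cong) (auto simp: e'_def)
      then show ?thesis using g[of u] fin by (simp add: E_def family_comb_def)
    qed
    obtain L' where L': "linear_automorphism I L'" "\<And>M. M \<in> J \<Longrightarrow> L' (?V M) = e' M"
      using sym_bracket_prod_automorphism[of e' d k m] e' family_indep[OF e'_\<iota>]
      unfolding I_def J_def by blast
    have linL': "linear_between I I L'" using L'(1) by (rule linear_automorphism_linear_between)
    have L'A: "L' (A z) = E z" if "z \<in> coord_space J" for z
      unfolding A_def E_def using linear_between_apply_family_comb[OF fin(2) V linL' L'(2) that] .
    have AZ: "A ` Z \<subseteq> coord_space I" using linear_betweenD(1)[OF A] Z by blast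
    have "(\<lambda>p. L' ` p) ` projectivization (A ` Z) = projectivization (L' ` A ` Z)"
    proof (rule image_projectivization[OF linL' AZ])
      fix v assume v: "v \<in> A ` Z" "L' v = (\<lambda>_. 0)"
      have "inj_on L' (coord_space I)" using L'(1) by (simp add: linear_automorphism_def bij_betw_def)
      moreover have "(\<lambda>_. 0) \<in> coord_space I" by (simp add: coord_space_def)
      ultimately show "v = (\<lambda>_. 0)"
        using v AZ linear_between_zero[OF linL'] by (metis inj_onD subsetD)
    qed
    also have "L' ` A ` Z = E ` Z"
      unfolding image_image using L'A Z by (intro image_cong) auto
    also have "E ` Z = zariski_closure I (E ` S)"
      unfolding Z_def by (rule zariski_closure_linear_image[OF fin E restrict rE S, symmetric])
    also have "projectivization \<dots> = proj_closure I (projectivization (E ` S))"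
    proof (rule proj_closure_cone[symmetric])
      show "E ` S \<subseteq> coord_space I" using linear_betweenD(1)[OF E] S by blast
      show "(\<lambda>i. c * s i) \<in> E ` S" if s: "s \<in> E ` S" for c s
      proof -
        obtain z where z: "z \<in> S" "s = E z" using s by blast
        then have "(\<lambda>i. c * s i) = E (\<lambda>M. c * z M)" using linear_betweenD(3)[OF E] S by auto
        then show ?thesis using cone[OF z(1)] by blast
      qed
      show "E s0 \<in> E ` S" using s0(1) by blast
      have "restrict (E s0) M0 \<noteq> 0" using rE s0 S by auto
      then show "E s0 \<noteq> (\<lambda>_. 0)" using linear_between_zero[OF restrict] by metis
    qed
    also have "projectivization (E ` S) = monomial_image I (\<lambda>u. image_mset to_nat (g u))"
    proof -
      \<comment> \<open>The variables \<open>x\<^sub>w\<close> are renamed to natural numbers by an enumeration of the words.\<close>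
      let ?f = "\<lambda>y u. if u \<in> I then eval_monom y (image_mset to_nat (g u)) else 0"
      have f: "?f y = E (?mon (\<lambda>w. y (to_nat w)))" for y :: "nat \<Rightarrow> complex"
        using g by (auto simp: E_apply fun_eq_iff weighted_monomial_vec_def J_def[symmetric]
            eval_monom_def image_mset.compositionality comp_def)
      have "E (?mon x) = ?f (\<lambda>n. x (from_nat n))" for x
        unfolding f by simp
      then have "range ?f = E ` S" unfolding S_def image_image using f by blast
      then show ?thesis by (simp add: monomial_image_def)
    qed
    finally show ?thesis unfolding toric_def rough using L'(1) by blast
  qed

  show ?thesis using monomial iso toric unfolding I_def J_def by blast
qed

end
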